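(* Let $S$ and $S'$ be ordered semigroups satisfying axioms O1–O5 and suppose that $S'$ has real multiplication. Let $\alpha\colon S\to S'$ be an ordered semigroup map that preserves the suprema of increasing sequences. Then there exists a unique ordered semigroup map $\overline{\alpha}\colon S_{\mathbb{R}}\to S'$ that preserves the suprema of increasing sequences and such that $\overline{\alpha}(\hat s)=\alpha(s)$ for all $s\in S$.
   Context: An ordered semigroup is an abelian monoid with a translation invariant order relation in which $0$ is the smallest element. An ordered semigroup map is one preserving the order, addition and $0$. For $s,t$ in an ordered set, $s\ll t$ means: for every increasing sequence $(t_n)$ (having a supremum) with $t\leq \sup_n t_n$ there is $n_0$ with $s\leq t_{n_0}$. Axioms on an ordered semigroup $S$: O1: every increasing sequence has a supremum. O2: every $s\in S$ is the supremum of a sequence $(s_n)$ with $s_n\ll s_{n+1}$ for all $n$. O3: if $s_i\ll t_i$ for $i=1,2$ then $s_1+s_2\ll t_1+t_2$. O4: if $(s_n),(t_n)$ are increasing then $\sup_n(s_n+t_n)=\sup_n s_n+\sup_n t_n$. O5: if $s'\ll s\leq t$ then there exists $r$ with $s'+r\leq t\leq s+r$. An ordered semigroup $O$ has real multiplication if there exists a map $(0,\infty]\times O\to O$, $(t,s)\mapsto t\cdot s$, that is additive in both variables, order preserving in both variables, preserves suprema of (increasing) sequences in both variables, and satisfies $1\cdot s=s$ for all $s$. A functional on $S$ is a map $\lambda\colon S\to[0,\infty]$ that is additive, order preserving, sends $0$ to $0$, and preserves suprema of increasing sequences. $\mathrm{F}(S)$ is the cone of all functionals, with the topology in which a net $(\lambda_i)$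 converges to $\lambda$ iff $\limsup_i\lambda_i(s')\leq\lambda(s)\leq\liminf_i\lambda_i(s)$ for all $s'\ll s$ in $S$. $\mathrm{Lsc}(\mathrm{F}(S))$ is the set of lower semicontinuous functions $f\colon\mathrm{F}(S)\to[0,\infty]$ that are linear (additive, homogeneous for positive real scalars, $f(0)=0$), with pointwise order and operations. For $s\in S$, $\hat s\in\mathrm{Lsc}(\mathrm{F}(S))$ is $\hat s(\lambda)=\lambda(s)$. $S_{\mathbb{R}}\subseteq \mathrm{Lsc}(\mathrm{F}(S))$ is the ordered semigroup of functions $f$ for which there are $s_i\in S$ and positive integers $n_i$ ($i=1,2,\dots$) such that $(\hat s_i/n_i)_i$ is increasing and $f(\lambda)=\sup_i \hat s_i(\lambda)/n_i$ for all $\lambda\in\mathrm{F}(S)$. *)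

theory Defs
  imports "HOL-Analysis.Analysis" "HOL-Library.Lub_Glb"
begin

section \<open>Ordered semigroups and the axioms O1--O5\<close>

text \<open>The parent class provides an abelian monoid with a translation invariant partial order.\<close>

class ordered_semigroup = ordered_comm_monoid_add +
  assumes ordered_semigroup_zero_least: "0 \<le> a"

instance ennreal :: ordered_semigroup
  by standard simp

text \<open>Suprema are relational, because only some subsets of an ordered semigroup have one.\<close>

abbreviation is_seq_sup :: "(nat \<Rightarrow> 'a::order) \<Rightarrow> 'a \<Rightarrow> bool"
  where "is_seq_sup x u \<equiv> isLub UNIV (range x) u"

definition preserves_seq_sups :: "('a::order \<Rightarrow> 'b::order) \<Rightarrow> bool"
  where "preserves_seq_sups f \<longleftrightarrow>
    (\<forall>x u. incseq x \<longrightarrow> is_seq_sup x u \<longrightarrow> is_seq_sup (\<lambda>n. f (x n)) (f u))"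

definition ordered_semigroup_map :: "('a::ordered_semigroup \<Rightarrow> 'b::ordered_semigroup) \<Rightarrow> bool"
  where "ordered_semigroup_map f \<longleftrightarrow>
    mono f \<and> (\<forall>a b. f (a + b) = f a + f b) \<and> f 0 = 0"

definition way_below :: "'a::order \<Rightarrow> 'a \<Rightarrow> bool"  (infix \<open>\<lless>\<close> 50)
  where "s \<lless> t \<longleftrightarrow>
    (\<forall>x u. incseq x \<longrightarrow> is_seq_sup x u \<longrightarrow> t \<le> u \<longrightarrow> (\<exists>n. s \<le> x n))"

definition axiom_O1 :: "'a::ordered_semigroup itself \<Rightarrow> bool"
  where "axiom_O1 _ \<longleftrightarrow> (\<forall>x :: nat \<Rightarrow> 'a. incseq x \<longrightarrow> (\<exists>u. is_seq_sup x u))"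

definition axiom_O2 :: "'a::ordered_semigroup itself \<Rightarrow> bool"
  where "axiom_O2 _ \<longleftrightarrow>
    (\<forall>s :: 'a. \<exists>x. (\<forall>n. x n \<lless> x (Suc n)) \<and> is_seq_sup x s)"

definition axiom_O3 :: "'a::ordered_semigroup itself \<Rightarrow> bool"
  where "axiom_O3 _ \<longleftrightarrow>
    (\<forall>s1 t1 s2 t2 :: 'a. s1 \<lless> t1 \<longrightarrow> s2 \<lless> t2 \<longrightarrow> s1 + s2 \<lless> t1 + t2)"

definition axiom_O4 :: "'a::ordered_semigroup itself \<Rightarrow> bool"
  where "axiom_O4 _ \<longleftrightarrow>
    (\<forall>(x :: nat \<Rightarrow> 'a) y u v. incseq x \<longrightarrow> incseq y \<longrightarrow> is_seq_sup x u \<longrightarrow> is_seq_sup y v \<longrightarrow>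
       is_seq_sup (\<lambda>n. x n + y n) (u + v))"

definition axiom_O5 :: "'a::ordered_semigroup itself \<Rightarrow> bool"
  where "axiom_O5 _ \<longleftrightarrow>
    (\<forall>s' s t :: 'a. s' \<lless> s \<longrightarrow> s \<le> t \<longrightarrow> (\<exists>r. s' + r \<le> t \<and> t \<le> s + r))"

definition axioms_O1_O5 :: "'a::ordered_semigroup itself \<Rightarrow> bool"
  where "axioms_O1_O5 T \<longleftrightarrow>
    axiom_O1 T \<and> axiom_O2 T \<and> axiom_O3 T \<and> axiom_O4 T \<and> axiom_O5 T"


section \<open>Real multiplication\<close>

text \<open>The scalars range over \<open>(0,\<infinity>]\<close>, that is, over the positive elements of
  \<^typ>\<open>ennreal\<close>; the value of \<open>m 0\<close> is irrelevant.\<close>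

definition real_multiplication :: "(ennreal \<Rightarrow> 'a::ordered_semigroup \<Rightarrow> 'a) \<Rightarrow> bool"
  where "real_multiplication m \<longleftrightarrow>
    (\<forall>t u s. 0 < t \<longrightarrow> 0 < u \<longrightarrow> m (t + u) s = m t s + m u s) \<and>
    (\<forall>t a b. 0 < t \<longrightarrow> m t (a + b) = m t a + m t b) \<and>
    (\<forall>t u s. 0 < t \<longrightarrow> t \<le> u \<longrightarrow> m t s \<le> m u s) \<and>
    (\<forall>t a b. 0 < t \<longrightarrow> a \<le> b \<longrightarrow> m t a \<le> m t b) \<and>
    (\<forall>t s. incseq t \<longrightarrow> (\<forall>n. 0 < t n) \<longrightarrow> is_seq_sup (\<lambda>n. m (t n) s) (m (SUP n. t n) s)) \<and>
    (\<forall>t. 0 < t \<longrightarrow> preserves_seq_sups (m t)) \<and>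
    (\<forall>s. m 1 s = s)"

definition has_real_multiplication :: "'a::ordered_semigroup itself \<Rightarrow> bool"
  where "has_real_multiplication _ \<longleftrightarrow>
    (\<exists>m :: ennreal \<Rightarrow> 'a \<Rightarrow> 'a. real_multiplication m)"


section \<open>The cone of functionals\<close>

lemma is_seq_sup_SUP: "is_seq_sup x (SUP n. x n)" for x :: "nat \<Rightarrow> 'a::complete_lattice"
  by (auto simp: isLub_def leastP_def isUb_def setle_def setge_def intro: SUP_upper SUP_least)

lemma is_seq_sup_iff_SUP: "is_seq_sup x u \<longleftrightarrow> (SUP n. x n) = u"
  for x :: "nat \<Rightarrow> 'a::complete_lattice"
  by (metis (no_types) is_seq_sup_SUP isLub_def isLub_isUb leastPD2 leastPD1 mem_Collect_eq
      order_antisym setgeD)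

lemma preserves_seq_sups_ennreal_iff:
  "preserves_seq_sups f \<longleftrightarrow> (\<forall>x u. incseq x \<longrightarrow> is_seq_sup x u \<longrightarrow> (SUP n. f (x n)) = f u)"
  for f :: "'a::order \<Rightarrow> ennreal"
  by (simp only: preserves_seq_sups_def is_seq_sup_iff_SUP)

typedef (overloaded) 'a functional =
  "{l :: 'a::ordered_semigroup \<Rightarrow> ennreal. ordered_semigroup_map l \<and> preserves_seq_sups l}"
  morphisms functional_apply Abs_functional
  by (rule exI[of _ "\<lambda>_. 0"])
    (auto simp: ordered_semigroup_map_def preserves_seq_sups_ennreal_iff mono_def)

setup_lifting type_definition_functional

lemma functional_mono: "a \<le> b \<Longrightarrow> functional_apply l a \<le> functional_apply l b"
  and functional_add: "functional_apply l (a + b) = functional_apply l a + functional_apply l b"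
  and functional_zero: "functional_apply l 0 = 0"
  using functional_apply[of l] by (auto simp: ordered_semigroup_map_def mono_def)

instantiation functional :: (ordered_semigroup) "{zero, plus}"
begin

lift_definition zero_functional :: "'a functional" is "\<lambda>_. 0"
  by (auto simp: ordered_semigroup_map_def preserves_seq_sups_ennreal_iff mono_def)

lift_definition plus_functional :: "'a functional \<Rightarrow> 'a functional \<Rightarrow> 'a functional"
  is "\<lambda>l m s. l s + m s"
  by (auto simp: ordered_semigroup_map_def preserves_seq_sups_ennreal_iff mono_def
      add_mono ac_simps ennreal_SUP_add)

instance ..

end

text \<open>This is used for \<open>c > 0\<close> only; a negative \<open>c\<close> acts as \<open>0\<close>.\<close>

lift_definition scale_functional :: "real \<Rightarrow> 'a::ordered_semigroup functional \<Rightarrow> 'a functional"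
  is "\<lambda>c l s. ennreal c * l s"
  by (auto simp: ordered_semigroup_map_def preserves_seq_sups_ennreal_iff mono_def
      mult_left_mono distrib_left SUP_mult_left_ennreal[symmetric])

text \<open>Convergence of nets, expressed by filters: a net corresponds to the image of the eventuality
  filter of its index set.\<close>

definition functional_converges ::
    "'a::ordered_semigroup functional filter \<Rightarrow> 'a functional \<Rightarrow> bool"
  where "functional_converges F l \<longleftrightarrow>
    (\<forall>s' s. s' \<lless> s \<longrightarrow>
       Limsup F (\<lambda>m. functional_apply m s') \<le> functional_apply l s \<and>
       functional_apply l s \<le> Liminf F (\<lambda>m. functional_apply m s))"

text \<open>The topology determined by this convergence; the lemma \<open>nhds_functional_iff\<close> below shows that
  its convergent filters are exactly the given ones.\<close>

instantiation functional :: (ordered_semigroup) topological_space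
begin

definition open_functional :: "'a functional set \<Rightarrow> bool"
  where "open U \<longleftrightarrow>
    (\<forall>l\<in>U. \<forall>F. functional_converges F l \<longrightarrow> eventually (\<lambda>m. m \<in> U) F)"

instance
proof
  show "open (UNIV :: 'a functional set)"
    by (simp add: open_functional_def)
  show "open (U \<inter> V)" if "open U" "open V" for U V :: "'a functional set"
    using that by (auto simp: open_functional_def eventually_conj_iff)
  show "open (\<Union>K)" if "\<forall>U\<in>K. open U" for K :: "'a functional set set"
    unfolding open_functional_def
  proof (intro ballI allI impI)
    fix l :: "'a functional" and F
    assume "l \<in> \<Union>K" and F: "functional_converges F l"
    then obtain U where U: "U \<in> K" "l \<in> U"
      by blast
    with that F have "eventually (\<lambda>m. m \<in> U) F"
      by (simp add: open_functional_def)
    then show "eventually (\<lambda>m. m \<in> \<Union>K) F"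
      by (rule eventually_mono) (use U in blast)
  qed
qed

end

lemma zero_way_below: "(0::'a::ordered_semigroup) \<lless> s"
  by (simp add: way_below_def ordered_semigroup_zero_least)

lemma open_functional_greater:
  fixes s :: "'a::ordered_semigroup"
  shows "open {l. a < functional_apply l s}"
  unfolding open_functional_def
proof (intro ballI allI impI)
  fix l :: "'a functional" and F
  assume "l \<in> {l. a < functional_apply l s}" and F: "functional_converges F l"
  then have "a < functional_apply l s"
    by simp
  also have "\<dots> \<le> Liminf F (\<lambda>m. functional_apply m s)"
    using F zero_way_below[of s] by (auto simp: functional_converges_def)
  finally show "\<forall>\<^sub>F m in F. m \<in> {l. a < functional_apply l s}"
    by (auto dest: less_LiminfD)
qed

lemma way_below_interpolate:
  assumes O2: "axiom_O2 TYPE('a::ordered_semigroup)" and "s' \<lless> (s::'a)"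
  obtains r where "s' \<lless> r" "r \<lless> s"
proof -
  have way_below_le: "a \<le> b" if "a \<lless> b" for a b :: 'a
  proof -
    have "is_seq_sup (\<lambda>_. b) b"
      by (auto simp: isLub_def leastP_def isUb_def setle_def setge_def)
    with that show ?thesis
      unfolding way_below_def by (metis incseq_const order_refl)
  qed
  have wb_trans1: "a \<lless> c" if "a \<le> b" "b \<lless> c" for a b c :: 'a
    using that unfolding way_below_def by (meson order_trans)
  have wb_trans2: "a \<lless> c" if "a \<lless> b" "b \<le> c" for a b c :: 'a
    using that unfolding way_below_def by (meson order_trans)
  obtain x where x: "\<And>n. x n \<lless> x (Suc n)" "is_seq_sup x s"
    using O2 unfolding axiom_O2_def by blast
  have "incseq x"
    by (simp add: incseq_SucI way_below_le x(1))
  then obtain n where "s' \<le> x n"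
    using assms(2) x(2) unfolding way_below_def by blast
  then have "s' \<lless> x (Suc n)"
    using x(1) wb_trans1 by blast
  moreover have "x (Suc n) \<lless> s"
    using x(1)[of "Suc n"] isLubD2[OF x(2)] wb_trans2 by blast
  ultimately show ?thesis
    using that by blast
qed

lemma open_functional_less:
  fixes s' :: "'a::ordered_semigroup"
  assumes "axiom_O2 TYPE('a)"
  shows "open {l. \<exists>s. s' \<lless> s \<and> functional_apply l s < a}"
  unfolding open_functional_def
proof (intro ballI allI impI)
  fix l :: "'a functional" and F
  assume l: "l \<in> {l. \<exists>s. s' \<lless> s \<and> functional_apply l s < a}"
    and F: "functional_converges F l"
  from l obtain s where s: "s' \<lless> s" "functional_apply l s < a"
    by blast
  obtain r where r: "s' \<lless> r" "r \<lless> s"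
    using way_below_interpolate[OF assms s(1)] by blast
  have "Limsup F (\<lambda>m. functional_apply m r) < a"
    using F r(2) s(2) unfolding functional_converges_def by (meson le_less_trans)
  then have "\<forall>\<^sub>F m in F. functional_apply m r < a"
    by (rule Limsup_lessD)
  then show "\<forall>\<^sub>F m in F. m \<in> {l. \<exists>s. s' \<lless> s \<and> functional_apply l s < a}"
    by eventually_elim (use r(1) in blast)
qed

lemma nhds_functional_iff:
  fixes l :: "'a::ordered_semigroup functional"
  assumes "axiom_O2 TYPE('a)"
  shows "F \<le> nhds l \<longleftrightarrow> functional_converges F l"
proof
  assume "functional_converges F l"
  then show "F \<le> nhds l"
    unfolding le_filter_def eventually_nhds open_functional_def
    by (smt (verit) eventually_mono)
next
  assume le: "F \<le> nhds l"
  have ev: "\<forall>\<^sub>F m in F. m \<in> U" if "open U" "l \<in> U" for U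
    using le that eventually_nhds_in_open filter_leD by blast
  show "functional_converges F l"
    unfolding functional_converges_def
  proof (intro allI impI conjI)
    fix s' s :: 'a assume s: "s' \<lless> s"
    show "functional_apply l s \<le> Liminf F (\<lambda>m. functional_apply m s)"
      unfolding le_Liminf_iff using ev[OF open_functional_greater] by auto
    show "Limsup F (\<lambda>m. functional_apply m s') \<le> functional_apply l s"
      unfolding Limsup_le_iff
    proof (intro allI impI)
      fix y assume "functional_apply l s < y"
      then have "\<forall>\<^sub>F m in F. \<exists>s. s' \<lless> s \<and> functional_apply m s < y"
        using ev[OF open_functional_less[OF assms, of s' y]] s by auto
      then show "\<forall>\<^sub>F m in F. functional_apply m s' < y"
      proof eventually_elim
        case (elim m)
        then obtain r where r: "s' \<lless> r" "functional_apply m r < y"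
          by blast
        have "is_seq_sup (\<lambda>_. r) r"
          by (auto simp: isLub_def leastP_def isUb_def setle_def setge_def)
        then have "s' \<le> r"
          using r(1) unfolding way_below_def by (metis incseq_const order_refl)
        then show ?case
          using functional_mono[of s' r m] r(2) by simp
      qed
    qed
  qed
qed


section \<open>Lower semicontinuous linear functions and the realification\<close>

definition Lsc :: "('a::ordered_semigroup functional \<Rightarrow> ennreal) set"
  where "Lsc = {f. (\<forall>a. open {l. a < f l}) \<and>
    (\<forall>l m. f (l + m) = f l + f m) \<and>
    (\<forall>c l. 0 < c \<longrightarrow> f (scale_functional c l) = ennreal c * f l) \<and>
    f 0 = 0}"

definition hat :: "'a::ordered_semigroup \<Rightarrow> 'a functional \<Rightarrow> ennreal"
  where "hat s = (\<lambda>l. functional_apply l s)"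

definition realification_set :: "('a::ordered_semigroup functional \<Rightarrow> ennreal) set"
  where "realification_set = {f \<in> Lsc. \<exists>(s :: nat \<Rightarrow> 'a) (n :: nat \<Rightarrow> nat).
    (\<forall>i. 0 < n i) \<and>
    incseq (\<lambda>i l. hat (s i) l / of_nat (n i)) \<and>
    (\<forall>l. f l = (SUP i. hat (s i) l / of_nat (n i)))}"

lemma SUP_hat_in_Lsc:
  fixes s :: "nat \<Rightarrow> 'a::ordered_semigroup"
  assumes n: "\<And>i. 0 < n i" and inc: "incseq (\<lambda>i l. hat (s i) l / of_nat (n i))"
  shows "(\<lambda>l. SUP i. hat (s i) l / of_nat (n i)) \<in> Lsc"
proof -
  have "open {l. a < (SUP i. hat (s i) l / of_nat (n i))}" for a
  proof -
    have "{l. a < (SUP i. hat (s i) l / of_nat (n i))} =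
      (\<Union>i. {l. a * of_nat (n i) < functional_apply l (s i)})"
    proof -
      have "a < x / of_nat (n i) \<longleftrightarrow> a * of_nat (n i) < x" for x i
      proof -
        have c: "of_nat (n i) \<noteq> (0 :: ennreal)" "of_nat (n i) \<noteq> (top :: ennreal)"
          using n[of i] by simp_all
        have "x \<le> a * of_nat (n i)" if "x / of_nat (n i) \<le> a"
          using mult_right_mono[OF that, of "of_nat (n i)"] c
          by (simp add: ennreal_divide_times ennreal_mult_divide_eq ennreal_times_divide)
        moreover have "x / of_nat (n i) \<le> a" if "x \<le> a * of_nat (n i)"
          using divide_right_mono_ennreal[OF that, of "of_nat (n i)"] c
          by (simp add: ennreal_mult_divide_eq)
        ultimately show ?thesis
          by (meson leD leI)
      qed
      then show ?thesis
        by (auto simp: less_SUP_iff hat_def)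
    qed
    then show ?thesis
      by (auto intro: open_functional_greater)
  qed
  moreover have "incseq (\<lambda>i. hat (s i) l / of_nat (n i))" for l
    using inc by (simp add: mono_def le_fun_def)
  then have "(SUP i. hat (s i) (l + m) / of_nat (n i)) =
      (SUP i. hat (s i) l / of_nat (n i)) + (SUP i. hat (s i) m / of_nat (n i))" for l m
    by (simp add: hat_def plus_functional.rep_eq add_divide_distrib_ennreal ennreal_SUP_add)
  ultimately show ?thesis
    by (simp add: Lsc_def hat_def scale_functional.rep_eq zero_functional.rep_eq
        SUP_mult_left_ennreal ennreal_times_divide)
qed

lemma realification_setI:
  fixes s :: "nat \<Rightarrow> 'a::ordered_semigroup"
  assumes "\<And>i. 0 < n i" "incseq (\<lambda>i l. hat (s i) l / of_nat (n i))"
    "\<And>l. f l = (SUP i. hat (s i) l / of_nat (n i))"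
  shows "f \<in> realification_set"
proof -
  have "f = (\<lambda>l. SUP i. hat (s i) l / of_nat (n i))"
    using assms(3) by blast
  then have "f \<in> Lsc"
    using SUP_hat_in_Lsc[OF assms(1,2)] by simp
  then show ?thesis
    using assms unfolding realification_set_def by blast
qed

lemma hat_in_realification_set: "hat s \<in> realification_set"
  by (rule realification_setI[of "\<lambda>_. 1" "\<lambda>_. s"]) (auto simp: mono_def divide_ennreal_def)

primrec nsum :: "nat \<Rightarrow> 'a::comm_monoid_add \<Rightarrow> 'a"
  where "nsum 0 a = 0" | "nsum (Suc k) a = a + nsum k a"

lemma functional_nsum: "functional_apply l (nsum k s) = of_nat k * functional_apply l s"
  by (induction k) (simp_all add: functional_zero functional_add distrib_right)

lemma add_in_realification_set:
  fixes f g :: "'a::ordered_semigroup functional \<Rightarrow> ennreal"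
  assumes "f \<in> realification_set" "g \<in> realification_set"
  shows "(\<lambda>l. f l + g l) \<in> realification_set"
proof -
  obtain s n where f: "\<And>i. 0 < n i" "incseq (\<lambda>i l. hat (s i) l / of_nat (n i))"
    "\<And>l. f l = (SUP i. hat (s i) l / of_nat (n i :: nat))"
    using assms(1) unfolding realification_set_def by blast
  obtain t m where g: "\<And>i. 0 < m i" "incseq (\<lambda>i l. hat (t i) l / of_nat (m i))"
    "\<And>l. g l = (SUP i. hat (t i) l / of_nat (m i :: nat))"
    using assms(2) unfolding realification_set_def by blast
  define r where "r i = nsum (m i) (s i) + nsum (n i) (t i)" for i
  have cancel: "(of_nat k * x) / of_nat (j * k) = x / (of_nat j :: ennreal)"
    if "0 < k" "0 < j" for k j :: nat and x
    using that divide_mult_eq[of "of_nat k" x "of_nat j"] by (simp add: mult.commute)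
  have r: "hat (r i) l / of_nat (n i * m i)
      = hat (s i) l / of_nat (n i) + hat (t i) l / of_nat (m i)" for i l
    using cancel[of "m i" "n i" "functional_apply l (s i)"]
      cancel[of "n i" "m i" "functional_apply l (t i)"] f(1)[of i] g(1)[of i]
    by (simp add: r_def hat_def functional_add functional_nsum add_divide_distrib_ennreal mult.commute)
  have inc: "incseq (\<lambda>i. hat (s i) l / of_nat (n i))" "incseq (\<lambda>i. hat (t i) l / of_nat (m i))" for l
    using f(2) g(2) by (simp_all add: mono_def le_fun_def)
  show ?thesis
  proof (rule realification_setI)
    show "0 < n i * m i" for i
      using f(1) g(1) by simp
    show "incseq (\<lambda>i l. hat (r i) l / of_nat (n i * m i))"
      unfolding r using inc by (auto simp: mono_def le_fun_def intro!: add_mono)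
    show "f l + g l = (SUP i. hat (r i) l / of_nat (n i * m i))" for l
      unfolding r f(3) g(3) using inc by (simp add: ennreal_SUP_add)
  qed
qed

text \<open>The ordered semigroup \<open>S\<^sub>\<real>\<close>, with pointwise order and addition.\<close>

typedef (overloaded) 'a realification =
  "realification_set :: ('a::ordered_semigroup functional \<Rightarrow> ennreal) set"
  morphisms realification_apply Abs_realification
  using hat_in_realification_set by blast

setup_lifting type_definition_realification

instantiation realification :: (ordered_semigroup) ordered_semigroup
begin

lift_definition zero_realification :: "'a realification" is "\<lambda>_. 0"
  using hat_in_realification_set[of 0] by (simp add: hat_def functional_zero)

lift_definition plus_realification ::
    "'a realification \<Rightarrow> 'a realification \<Rightarrow> 'a realification"
  is "\<lambda>f g l. f l + g l"
  by (rule add_in_realification_set)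

lift_definition less_eq_realification :: "'a realification \<Rightarrow> 'a realification \<Rightarrow> bool"
  is "(\<le>)" .

lift_definition less_realification :: "'a realification \<Rightarrow> 'a realification \<Rightarrow> bool"
  is "(<)" .

instance
proof
  fix f g h :: "'a realification"
  show "f + g + h = f + (g + h)"
    by transfer (simp add: add.assoc)
  show "f + g = g + f"
    by transfer (simp add: add.commute)
  show "0 + f = f"
    by transfer simp
  show "f < g \<longleftrightarrow> f \<le> g \<and> \<not> g \<le> f"
    by transfer (rule less_le_not_le)
  show "f \<le> f"
    by transfer (rule order_refl)
  show "f \<le> h" if "f \<le> g" "g \<le> h"
    using that by transfer (rule order_trans)
  show "f = g" if "f \<le> g" "g \<le> f"
    using that by transfer (rule order_antisym)
  show "h + f \<le> h + g" if "f \<le> g"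
    using that by transfer (simp add: le_fun_def add_left_mono)
  show "0 \<le> f"
    by transfer (simp add: le_fun_def)
qed

end

lift_definition realification_hat :: "'a::ordered_semigroup \<Rightarrow> 'a realification" is hat
  by (rule hat_in_realification_set)

end

(*
  Everything is tested against functionals. In S', real multiplication makes the order determined by
  F(S'): if x is not below y, then some x' way below x and some rational c > 1 satisfy
  n x' <= c n y for no n > 0. If x' lies below no multiple of y, a map with values 0 and oo
  separates them. Otherwise a maximal translation invariant preorder (Zorn) that puts x' above
  some multiple d y, with 1 < d < c, without collapsing the ray of y is total on the part bounded by
  that ray. Measuring against y then gives an additive map separating x' from y, and regularizing it
  along way-below gives a functional.

  Hence beta(f) must be the unique t in S' with lambda(t) = f(lambda o alpha) for all lambda in
  F(S'). It exists as the supremum of the alpha(s_i)/n_i, and additivity and monotonicity are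
  immediate. Suprema of increasing sequences are preserved because they are pointwise in the
  realification. This last fact is a diagonal argument, resting on the compactness (Tychonoff) of
  the set of additive monotone maps into [0,oo].
*)

theory Submission
  imports Defs
begin

section \<open>Increasing suprema and the way-below relation\<close>

lemma is_seq_supI:
  assumes "\<And>n. x n \<le> u" "\<And>v. (\<And>n. x n \<le> v) \<Longrightarrow> u \<le> v"
  shows "is_seq_sup x u"
  using assms by (auto simp: isLub_def leastP_def isUb_def setle_def setge_def)

lemma is_seq_sup_upper: "is_seq_sup x u \<Longrightarrow> x n \<le> u"
  by (auto simp: isLub_def leastP_def isUb_def setle_def setge_def)

lemma is_seq_sup_least: "is_seq_sup x u \<Longrightarrow> (\<And>n. x n \<le> v) \<Longrightarrow> u \<le> v"
  by (auto simp: isLub_def leastP_def isUb_def setle_def setge_def)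

lemma way_below_imp_le: "a \<lless> b \<Longrightarrow> a \<le> b"
  unfolding way_below_def
  by (metis incseq_const is_seq_supI order_refl)

lemma way_below_le_trans: "a \<lless> b \<Longrightarrow> b \<le> c \<Longrightarrow> a \<lless> c"
  unfolding way_below_def by (meson order_trans)

lemma way_belowE:
  assumes "a \<lless> b" "incseq x" "is_seq_sup x u" "b \<le> u"
  obtains n where "a \<le> x n"
  using assms unfolding way_below_def by blast

lemma axiom_O2E:
  fixes s :: "'a::ordered_semigroup"
  assumes "axiom_O2 TYPE('a)"
  obtains x where "\<And>n. x n \<lless> x (Suc n)" "incseq x" "is_seq_sup x s" "\<And>n. x n \<lless> s"
proof -
  obtain x where x: "\<And>n. x n \<lless> x (Suc n)" "is_seq_sup x s"
    using assms unfolding axiom_O2_def by blast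
  show ?thesis
  proof
    show "incseq x"
      by (simp add: incseq_SucI way_below_imp_le x(1))
    show "x n \<lless> s" for n
      using x(1) is_seq_sup_upper[OF x(2)] way_below_le_trans by blast
  qed (use x in auto)
qed

section \<open>Functionals and regularization along way-below\<close>

lemma functional_SUP:
  "incseq x \<Longrightarrow> is_seq_sup x u \<Longrightarrow> functional_apply l u = (SUP n. functional_apply l (x n))"
  using functional_apply[of l] by (auto simp: preserves_seq_sups_ennreal_iff)

lemma ordered_semigroup_mapD:
  assumes "ordered_semigroup_map f"
  shows "a \<le> b \<Longrightarrow> f a \<le> f b" "f (a + b) = f a + f b" "f 0 = 0"
  using assms by (auto simp: ordered_semigroup_map_def mono_def)

text \<open>Taking the supremum of \<open>\<mu>\<close> over everything way below the argument
  forces preservation of suprema, at the price of one way-below step. By O2 this supremum can be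
  computed along a single sequence; O3 and O4 allow two such sequences to be added termwise.\<close>

lemma functional_regularization:
  fixes \<mu> :: "'a::ordered_semigroup \<Rightarrow> ennreal"
  assumes "axioms_O1_O5 TYPE('a)" and \<mu>: "ordered_semigroup_map \<mu>"
  obtains l where "\<And>s. functional_apply l s \<le> \<mu> s"
    and "\<And>s' s. s' \<lless> s \<Longrightarrow> \<mu> s' \<le> functional_apply l s"
proof -
  have O2: "axiom_O2 TYPE('a)" and O3: "axiom_O3 TYPE('a)" and O4: "axiom_O4 TYPE('a)"
    using assms by (auto simp: axioms_O1_O5_def)
  note \<mu>D = ordered_semigroup_mapD[OF \<mu>]
  define l where "l s = (SUP r\<in>{r. r \<lless> s}. \<mu> r)" for s
  have l_seq: "l s = (SUP n. \<mu> (x n))" if x: "incseq x" "is_seq_sup x s" "\<And>n. x n \<lless> s" for x s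
  proof (rule antisym)
    show "l s \<le> (SUP n. \<mu> (x n))"
      unfolding l_def
    proof (rule SUP_least)
      fix r assume "r \<in> {r. r \<lless> s}"
      then obtain n where "r \<le> x n"
        using way_belowE[OF _ x(1,2)] by auto
      then show "\<mu> r \<le> (SUP n. \<mu> (x n))"
        by (meson \<mu>D(1) SUP_upper2 UNIV_I)
    qed
    show "(SUP n. \<mu> (x n)) \<le> l s"
      unfolding l_def using x(3) by (auto intro!: SUP_least SUP_upper)
  qed
  have l_mono: "l s \<le> l t" if "s \<le> t" for s t
    unfolding l_def using that by (auto intro!: SUP_mono intro: way_below_le_trans)
  have l_add: "l (s + t) = l s + l t" for s t
  proof -
    obtain x where x: "incseq x" "is_seq_sup x s" "\<And>n. x n \<lless> s"
      using axiom_O2E[OF O2] by metis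
    obtain y where y: "incseq y" "is_seq_sup y t" "\<And>n. y n \<lless> t"
      using axiom_O2E[OF O2] by metis
    have "l (s + t) = (SUP n. \<mu> (x n + y n))"
    proof (rule l_seq)
      show "incseq (\<lambda>n. x n + y n)"
        using x(1) y(1) by (auto simp: mono_def intro: add_mono)
      show "is_seq_sup (\<lambda>n. x n + y n) (s + t)"
        using O4 x y unfolding axiom_O4_def by blast
      show "x n + y n \<lless> s + t" for n
        using O3 x y unfolding axiom_O3_def by blast
    qed
    also have "\<dots> = l s + l t"
      unfolding \<mu>D l_seq[OF x] l_seq[OF y] using x(1) y(1)
      by (intro ennreal_SUP_add) (auto simp: mono_def intro: \<mu>D(1))
    finally show ?thesis .
  qed
  have l_le: "l s \<le> \<mu> s" for s
    unfolding l_def using \<mu>D(1)[OF way_below_imp_le] by (auto intro!: SUP_least)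
  have l_ge: "\<mu> r \<le> l s" if "r \<lless> s" for r s
    unfolding l_def using that by (auto intro: SUP_upper)
  have l_0: "l 0 = 0"
    using l_le[of 0] \<mu>D(3) by simp
  have l_sup: "(SUP n. l (x n)) = l u" if x: "incseq x" "is_seq_sup x u" for x u
  proof (rule antisym)
    show "(SUP n. l (x n)) \<le> l u"
      by (intro SUP_least l_mono is_seq_sup_upper[OF x(2)])
    show "l u \<le> (SUP n. l (x n))"
      unfolding l_def[of u]
    proof (rule SUP_least)
      fix r assume "r \<in> {r. r \<lless> u}"
      \<comment> \<open>The intermediate \<open>r'\<close> is essential: \<open>r \<le> x n\<close>
        alone would bound \<open>\<mu> r\<close> by \<open>\<mu> (x n)\<close>, not by
        \<open>l (x n)\<close>.\<close>
      then obtain r' where r: "r \<lless> r'" "r' \<lless> u"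
        using way_below_interpolate[OF O2, of r u] by blast
      then obtain n where "r' \<le> x n"
        using way_belowE[OF _ x] by auto
      then have "\<mu> r \<le> l (x n)"
        using r(1) by (intro l_ge) (rule way_below_le_trans)
      then show "\<mu> r \<le> (SUP n. l (x n))"
        by (meson SUP_upper2 UNIV_I)
    qed
  qed
  have "ordered_semigroup_map l \<and> preserves_seq_sups l"
    using l_mono l_add l_0 l_sup
    by (auto simp: ordered_semigroup_map_def preserves_seq_sups_ennreal_iff mono_def)
  then have "functional_apply (Abs_functional l) = l"
    by (simp add: Abs_functional_inverse)
  then show ?thesis
    using that[of "Abs_functional l"] l_le l_ge by simp
qed

section \<open>Multiples and translation invariant preorders\<close>

lemma nsum_add_right: "nsum n (a + b) = nsum n a + nsum n b"
  by (induction n) (simp_all add: ac_simps)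

lemma nsum_add_left: "nsum (n + k) a = nsum n a + nsum k a"
  by (induction n) (simp_all add: ac_simps)

lemma nsum_mult: "nsum (n * k) a = nsum n (nsum k a)"
  by (induction n) (simp_all add: nsum_add_left)

lemma nsum_mono: "a \<le> b \<Longrightarrow> nsum n a \<le> nsum n (b::'a::ordered_comm_monoid_add)"
  by (induction n) (auto intro: add_mono)

text \<open>A set of pairs, so that Zorn's lemma for inclusion applies. Reflexivity is implied,
  since the given order is contained.\<close>

definition cone_preorder :: "('a::ordered_semigroup \<times> 'a) set \<Rightarrow> bool"
  where "cone_preorder R \<longleftrightarrow> (\<forall>a b. a \<le> b \<longrightarrow> (a, b) \<in> R) \<and> trans R \<and>
    (\<forall>a b c. (a, b) \<in> R \<longrightarrow> (a + c, b + c) \<in> R)"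

lemma cone_preorderD:
  assumes "cone_preorder R"
  shows "a \<le> b \<Longrightarrow> (a, b) \<in> R" "(a, b) \<in> R \<Longrightarrow> (b, c) \<in> R \<Longrightarrow> (a, c) \<in> R"
    "(a, b) \<in> R \<Longrightarrow> (a + c, b + c) \<in> R"
  using assms unfolding cone_preorder_def by (auto dest: transD)

lemma cone_preorder_add:
  assumes "cone_preorder R" "(a, b) \<in> R" "(c, d) \<in> R"
  shows "(a + c, b + d) \<in> R"
  using cone_preorderD(2,3)[OF assms(1)] assms(2,3) by (metis add.commute)

lemma cone_preorder_nsum:
  assumes "cone_preorder R" "(a, b) \<in> R"
  shows "(nsum n a, nsum n b) \<in> R"
  by (induction n) (auto intro: cone_preorder_add assms cone_preorderD(1))

text \<open>The summand \<open>c\<close> acts as a catalyst: it is returned after each exchange of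
  one \<open>a\<close> for one \<open>b\<close>, so a single copy serves all \<open>n\<close>
  exchanges.\<close>

lemma cone_preorder_iterate:
  assumes "cone_preorder R" "(c + a, c + b) \<in> R"
  shows "(c + nsum n a, c + nsum n b) \<in> R"
proof (induction n)
  case 0
  then show ?case
    by (simp add: cone_preorderD(1)[OF assms(1)])
next
  case (Suc n)
  have "(c + nsum n a + a, c + nsum n b + a) \<in> R"
    using cone_preorderD(3)[OF assms(1) Suc] .
  moreover have "(c + a + nsum n b, c + b + nsum n b) \<in> R"
    using cone_preorderD(3)[OF assms(1,2)] .
  ultimately show ?case
    using cone_preorderD(2)[OF assms(1)] by (simp add: ac_simps)
qed

text \<open>The cone preorder generated by \<open>R\<close> and the single relation \<open>a \<le> b\<close>.\<close>

definition adjoin :: "('a::ordered_semigroup \<times> 'a) set \<Rightarrow> 'a \<Rightarrow> 'a \<Rightarrow> ('a \<times> 'a) set"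
  where "adjoin R a b = {(c, d). \<exists>k. (c + nsum k b, d + nsum k a) \<in> R}"

lemma cone_preorder_adjoin:
  assumes R: "cone_preorder R"
  shows "cone_preorder (adjoin R a b)"
  unfolding cone_preorder_def
proof (intro conjI allI impI transI)
  show "(c, d) \<in> adjoin R a b" if "c \<le> d" for c d
    using cone_preorderD(1)[OF R that] by (auto simp: adjoin_def intro: exI[of _ 0])
  show "(c + e, d + e) \<in> adjoin R a b" if "(c, d) \<in> adjoin R a b" for c d e
    using that cone_preorderD(3)[OF R, of _ _ e]
    by (fastforce simp: adjoin_def add.assoc add.commute[of e])
  fix c d e assume "(c, d) \<in> adjoin R a b" "(d, e) \<in> adjoin R a b"
  then obtain k l where k: "(c + nsum k b, d + nsum k a) \<in> R"
      and l: "(d + nsum l b, e + nsum l a) \<in> R"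
    by (auto simp: adjoin_def)
  have "(c + nsum k b + nsum l b, d + nsum k a + nsum l b) \<in> R"
    "(d + nsum l b + nsum k a, e + nsum l a + nsum k a) \<in> R"
    using cone_preorderD(3)[OF R k] cone_preorderD(3)[OF R l] by auto
  then have "(c + nsum (k + l) b, e + nsum (k + l) a) \<in> R"
    using cone_preorderD(2)[OF R] by (simp add: nsum_add_left ac_simps)
  then show "(c, e) \<in> adjoin R a b"
    unfolding adjoin_def by blast
qed

lemma adjoin_extends:
  assumes "cone_preorder R"
  shows "R \<subseteq> adjoin R a b" "(a, b) \<in> adjoin R a b"
  using cone_preorderD(1)[OF assms, of "a + b" "b + a"]
  by (auto simp: adjoin_def ac_simps intro: exI[of _ 0] exI[of _ 1])

section \<open>Gauges along a ray and separation by additive maps\<close>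

lemma le_Inf_add_Inf_ennreal:
  fixes v :: ennreal
  assumes "\<And>a b. a \<in> A \<Longrightarrow> b \<in> B \<Longrightarrow> v \<le> a + b"
  shows "v \<le> Inf A + Inf B"
proof (rule ennreal_le_epsilon)
  fix e :: real assume fin: "Inf A + Inf B < top" and e: "0 < e"
  have "u < u + ennreal (e/2)" if "u < top" for u
    using that e by (cases u) (auto simp: ennreal_plus[symmetric] ennreal_less_iff simp del: ennreal_plus)
  then have "Inf A < Inf A + ennreal (e/2)" "Inf B < Inf B + ennreal (e/2)"
    using fin by (auto simp: less_top[symmetric])
  then obtain a b where "a \<in> A" "a < Inf A + ennreal (e/2)" "b \<in> B" "b < Inf B + ennreal (e/2)"
    unfolding Inf_less_iff by blast
  then have "v \<le> (Inf A + ennreal (e/2)) + (Inf B + ennreal (e/2))"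
    using assms[of a b] by (meson add_mono less_imp_le order_trans)
  also have "\<dots> = Inf A + Inf B + (ennreal (e/2) + ennreal (e/2))"
    by (simp add: ac_simps)
  also have "ennreal (e/2) + ennreal (e/2) = ennreal e"
    using e by (simp add: ennreal_plus[symmetric] del: ennreal_plus)
  finally show "v \<le> Inf A + Inf B + ennreal e" .
qed

text \<open>A ray \<open>Y\<close> plays the role of the multiples \<open>r \<cdot> y\<close> of a fixed element \<open>y\<close>.\<close>

locale ray =
  fixes Y :: "real \<Rightarrow> 'b::ordered_semigroup"
  assumes ray_zero: "Y 0 = 0"
    and ray_add: "0 \<le> r \<Longrightarrow> 0 \<le> q \<Longrightarrow> Y (r + q) = Y r + Y q"
begin

lemma ray_mono: "0 \<le> r \<Longrightarrow> r \<le> q \<Longrightarrow> Y r \<le> Y q"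
  using ray_add[of r "q - r"] add_left_mono[OF ordered_semigroup_zero_least, of "Y r"] by simp

lemma nsum_ray: "0 \<le> r \<Longrightarrow> nsum n (Y r) = Y (real n * r)"
  by (induction n) (simp_all add: ray_zero ray_add distrib_right)

text \<open>Since \<open>Y\<close> is increasing on the nonnegative reals, this says that
  \<open>R\<close> restricts to their usual order along the ray.\<close>

definition admissible :: "('b \<times> 'b) set \<Rightarrow> bool"
  where "admissible R \<longleftrightarrow> cone_preorder R \<and> (\<forall>r q. 0 \<le> q \<longrightarrow> q < r \<longrightarrow> (Y r, Y q) \<notin> R)"

text \<open>Iteration would relate \<open>A + Y (n r)\<close> to \<open>A + Y (n q)\<close> for
  every \<open>n\<close>, with one copy of \<open>A\<close> throughout. Dropping \<open>A\<close> on
  the left and bounding it by \<open>Y K\<close> on the right costs a constant, which the gap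
  \<open>n (r - q)\<close> eventually exceeds.\<close>

lemma admissible_cancel:
  assumes R: "admissible R" and A: "(A, Y K) \<in> R" "0 \<le> K" and q: "0 \<le> q" "q < r"
  shows "(A + Y r, A + Y q) \<notin> R"
proof
  have cp: "cone_preorder R"
    using R by (simp add: admissible_def)
  note cpD = cone_preorderD[OF cp]
  assume "(A + Y r, A + Y q) \<in> R"
  then have it: "(A + Y (real n * r), A + Y (real n * q)) \<in> R" for n
    using cone_preorder_iterate[OF cp, of A "Y r" "Y q" n] q by (simp add: nsum_ray)
  obtain n :: nat where n: "K / (r - q) < real n"
    using reals_Archimedean2 by blast
  have "(Y (real n * r), A + Y (real n * r)) \<in> R"
    using add_right_mono[OF ordered_semigroup_zero_least, of "Y (real n * r)" A] by (intro cpD(1)) simp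
  moreover have "(A + Y (real n * q), Y (K + real n * q)) \<in> R"
    using cpD(3)[OF A(1)] A(2) q(1) by (simp add: ray_add)
  ultimately have "(Y (real n * r), Y (K + real n * q)) \<in> R"
    using it[of n] cpD(2) by blast
  moreover have "K + real n * q < real n * r"
    using n q by (simp add: field_simps)
  ultimately show False
    using R A(2) q(1) unfolding admissible_def by force
qed

text \<open>If neither relation held, then by maximality adjoining either one would collapse the
  ray. The two collapses combine so that \<open>a\<close> and \<open>b\<close> occur equally often
  on both sides, which contradicts \<open>admissible_cancel\<close>.\<close>

lemma maximal_admissible_total:
  assumes R: "admissible R" and max: "\<And>R'. admissible R' \<Longrightarrow> R \<subseteq> R' \<Longrightarrow> R' = R"
    and a: "(a, Y K) \<in> R" "0 \<le> K" and b: "(b, Y L) \<in> R" "0 \<le> L"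
  shows "(a, b) \<in> R \<or> (b, a) \<in> R"
proof (rule ccontr)
  assume neg: "\<not> ?thesis"
  have cp: "cone_preorder R"
    using R by (simp add: admissible_def)
  have viol: "\<exists>r q k. 0 \<le> q \<and> q < r \<and> (Y r + nsum k d, Y q + nsum k c) \<in> R"
    if "(c, d) \<notin> R" for c d
  proof -
    have "\<not> admissible (adjoin R c d)"
      using max[of "adjoin R c d"] adjoin_extends[OF cp] that by blast
    then obtain r q where "0 \<le> q" "q < r" "(Y r, Y q) \<in> adjoin R c d"
      using cone_preorder_adjoin[OF cp] unfolding admissible_def by blast
    then show ?thesis
      unfolding adjoin_def by blast
  qed
  obtain r q k where 1: "0 \<le> q" "q < r" "(Y r + nsum k b, Y q + nsum k a) \<in> R"
    using viol[of a b] neg by blast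
  obtain r' q' l where 2: "0 \<le> q'" "q' < r'" "(Y r' + nsum l a, Y q' + nsum l b) \<in> R"
    using viol[of b a] neg by blast
  \<comment> \<open>With \<open>k = 0\<close> the ray would be collapsed by \<open>R\<close> itself.
    Positivity of \<open>k\<close> makes the combined inequality of ray parameters strict.\<close>
  have k: "0 < k"
    using 1 R unfolding admissible_def by (cases k) auto
  \<comment> \<open>Adding \<open>l\<close> copies of the first collapse and \<open>k\<close> copies
    of the second leaves this same summand on both sides.\<close>
  define A where "A = nsum (l * k) a + nsum (l * k) b"
  have "(nsum l (Y r + nsum k b) + nsum k (Y r' + nsum l a),
      nsum l (Y q + nsum k a) + nsum k (Y q' + nsum l b)) \<in> R"
    by (intro cone_preorder_add cone_preorder_nsum cp 1(3) 2(3))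
  then have "(A + Y (real l * r + real k * r'), A + Y (real l * q + real k * q')) \<in> R"
    using 1(1,2) 2(1,2)
    by (simp add: A_def nsum_add_right nsum_ray ray_add nsum_mult[symmetric] ac_simps)
  moreover have "(A, Y (real (l * k) * K + real (l * k) * L)) \<in> R"
    using cone_preorder_add[OF cp cone_preorder_nsum[OF cp a(1)] cone_preorder_nsum[OF cp b(1)],
        of "l * k" "l * k"] a(2) b(2)
    by (simp add: A_def nsum_ray ray_add)
  moreover have "real l * q + real k * q' < real l * r + real k * r'"
    using 1(2) 2(2) k by (intro add_le_less_mono mult_left_mono mult_strict_left_mono) auto
  ultimately show False
    using admissible_cancel[OF R, of A "real (l * k) * K + real (l * k) * L"] a(2) b(2) 1(1) 2(1)
    by (metis add_nonneg_nonneg mult_nonneg_nonneg of_nat_0_le_iff)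
qed

text \<open>Zorn's lemma: transitivity concerns two pairs, which lie in a common member of the
  chain, and a collapse is a single pair.\<close>

lemma admissible_maximal_exists:
  assumes "admissible R0"
  obtains R where "admissible R" "R0 \<subseteq> R" "\<And>R'. admissible R' \<Longrightarrow> R \<subseteq> R' \<Longrightarrow> R' = R"
proof -
  define \<A> where "\<A> = {R. admissible R \<and> R0 \<subseteq> R}"
  have "\<exists>M\<in>\<A>. \<forall>X\<in>\<A>. M \<subseteq> X \<longrightarrow> X = M"
  proof (rule subset_Zorn_nonempty)
    show "\<A> \<noteq> {}"
      using assms by (auto simp: \<A>_def)
    fix \<C> assume ne: "\<C> \<noteq> {}" and chain: "subset.chain \<A> \<C>"
    have adm: "admissible R" "R0 \<subseteq> R" if "R \<in> \<C>" for R
      using chain that by (auto simp: subset.chain_def \<A>_def)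
    then have cp: "cone_preorder R" if "R \<in> \<C>" for R
      using that by (simp add: admissible_def)
    have "(a, c) \<in> \<Union>\<C>" if ab: "(a, b) \<in> \<Union>\<C>" "(b, c) \<in> \<Union>\<C>" for a b c
    proof -
      obtain R1 R2 where R: "R1 \<in> \<C>" "R2 \<in> \<C>" "(a, b) \<in> R1" "(b, c) \<in> R2"
        using ab by blast
      then have "R1 \<subseteq> R2 \<or> R2 \<subseteq> R1"
        using chain unfolding subset.chain_def by blast
      then show ?thesis
        using R cone_preorderD(2)[OF cp] by blast
    qed
    moreover have "(a, b) \<in> \<Union>\<C>" if "a \<le> b" for a b
      using ne cone_preorderD(1)[OF cp that] by blast
    moreover have "(a + c, b + c) \<in> \<Union>\<C>" if "(a, b) \<in> \<Union>\<C>" for a b c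
      using that cone_preorderD(3)[OF cp] by blast
    ultimately have "cone_preorder (\<Union>\<C>)"
      unfolding cone_preorder_def trans_def by blast
    then have "admissible (\<Union>\<C>)"
      using adm(1) unfolding admissible_def by blast
    then show "\<Union>\<C> \<in> \<A>"
      using ne adm(2) unfolding \<A>_def by blast
  qed
  then obtain M where "M \<in> \<A>" and M: "\<And>X. X \<in> \<A> \<Longrightarrow> M \<subseteq> X \<Longrightarrow> X = M"
    by blast
  then show ?thesis
    using that[of M] unfolding \<A>_def by blast
qed

text \<open>\<open>\<mu> a\<close> measures \<open>a\<close> from above in units of
  \<open>Y 1\<close>, with value \<open>top\<close> if no multiple bounds \<open>a\<close>.
  Subadditivity holds for any cone preorder. Superadditivity needs totality, by which bounded
  elements are measured from below as well.\<close>

lemma maximal_admissible_gauge: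
  assumes R: "admissible R" and max: "\<And>R'. admissible R' \<Longrightarrow> R \<subseteq> R' \<Longrightarrow> R' = R"
  defines "\<mu> \<equiv> (\<lambda>a. Inf {ennreal r | r. 0 \<le> r \<and> (a, Y r) \<in> R})"
  shows "ordered_semigroup_map \<mu>"
proof -
  have cp: "cone_preorder R"
    using R by (simp add: admissible_def)
  have \<mu>_eq: "\<mu> a = Inf {ennreal r | r. 0 \<le> r \<and> (a, Y r) \<in> R}" for a
    by (simp add: \<mu>_def)
  note cpD = cone_preorderD[OF cp]
  have \<mu>_le: "\<mu> a \<le> ennreal r" if "0 \<le> r" "(a, Y r) \<in> R" for a r
    unfolding \<mu>_eq using that by (auto intro: Inf_lower)
  have mono: "\<mu> a \<le> \<mu> b" if "a \<le> b" for a b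
    unfolding \<mu>_eq using cpD(2)[OF cpD(1)[OF that]] by (intro Inf_superset_mono) blast
  have "\<mu> 0 \<le> 0"
    using \<mu>_le[of 0 0] cpD(1)[of 0 0] by (simp add: ray_zero)
  moreover have "\<mu> (a + b) \<le> \<mu> a + \<mu> b" for a b
    unfolding \<mu>_eq[of a] \<mu>_eq[of b]
  proof (rule le_Inf_add_Inf_ennreal)
    fix u v assume "u \<in> {ennreal r | r. 0 \<le> r \<and> (a, Y r) \<in> R}"
      "v \<in> {ennreal r | r. 0 \<le> r \<and> (b, Y r) \<in> R}"
    then obtain r q where "u = ennreal r" "v = ennreal q" "0 \<le> r" "0 \<le> q"
      "(a, Y r) \<in> R" "(b, Y q) \<in> R"
      by blast
    then show "\<mu> (a + b) \<le> u + v"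
      using \<mu>_le[of "r + q" "a + b"] cone_preorder_add[OF cp, of a "Y r" b "Y q"]
      by (simp add: ray_add)
  qed
  moreover have "\<mu> a + \<mu> b \<le> \<mu> (a + b)" for a b
    unfolding \<mu>_eq[of "a + b"]
  proof (rule Inf_greatest)
    fix u assume "u \<in> {ennreal r | r. 0 \<le> r \<and> (a + b, Y r) \<in> R}"
    then obtain r where r: "u = ennreal r" "0 \<le> r" "(a + b, Y r) \<in> R"
      by blast
    \<comment> \<open>Below the infimum \<open>v\<close> the relation of \<open>c\<close> to
      \<open>Y (v - e)\<close> fails, so totality reverses it. The maximum with 0 keeps the
      parameter where the ray laws apply.\<close>
    have lower: "\<exists>v\<ge>0. \<mu> c = ennreal v \<and> (\<forall>e>0. (Y (max 0 (v - e)), c) \<in> R)"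
      if "c \<le> a + b" for c
    proof -
      have cR: "(c, Y r) \<in> R"
        using cpD(2)[OF cpD(1)[OF that] r(3)] .
      then have "\<mu> c \<noteq> top"
        using \<mu>_le[OF r(2) cR] by (auto simp: top_unique)
      then obtain v where v: "0 \<le> v" "\<mu> c = ennreal v"
        by (cases "\<mu> c") auto
      have "(Y (max 0 (v - e)), c) \<in> R" if "0 < e" for e
      proof (cases "v - e \<le> 0")
        case True
        then show ?thesis
          using cpD(1)[OF ordered_semigroup_zero_least] by (simp add: max_def ray_zero)
      next
        case False
        then have "(c, Y (v - e)) \<notin> R"
          using \<mu>_le[of "v - e" c] v that by (auto simp: ennreal_le_iff)
        then show ?thesis
          using maximal_admissible_total[OF R max cR r(2), of "Y (v - e)" "v - e"] False
            cpD(1)[OF order_refl] by (simp add: max_def)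
      qed
      with v show ?thesis
        by blast
    qed
    have "a \<le> a + b" "b \<le> a + b"
      using add_left_mono[OF ordered_semigroup_zero_least, of a b]
        add_right_mono[OF ordered_semigroup_zero_least, of b a] by simp_all
    then obtain v w where v: "0 \<le> v" "\<mu> a = ennreal v" "\<And>e. e > 0 \<Longrightarrow> (Y (max 0 (v - e)), a) \<in> R"
      and w: "0 \<le> w" "\<mu> b = ennreal w" "\<And>e. e > 0 \<Longrightarrow> (Y (max 0 (w - e)), b) \<in> R"
      using lower by metis
    have "v + w \<le> r + e" if "0 < e" for e
    proof -
      have "(Y (max 0 (v - e/2) + max 0 (w - e/2)), Y r) \<in> R"
        using cpD(2)[OF cone_preorder_add[OF cp v(3) w(3)] r(3), of "e/2" "e/2"] that
        by (simp add: ray_add)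
      then have "max 0 (v - e/2) + max 0 (w - e/2) \<le> r"
        using R r(2) unfolding admissible_def by (meson not_le)
      then show ?thesis
        by linarith
    qed
    then have "v + w \<le> r"
      by (rule field_le_epsilon)
    then show "\<mu> a + \<mu> b \<le> u"
      using v w r by (simp add: ennreal_plus[symmetric] del: ennreal_plus)
  qed
  ultimately show ?thesis
    using mono by (auto simp: ordered_semigroup_map_def mono_def intro: antisym)
qed

text \<open>Adjoining \<open>Y d \<le> x\<close>, with \<open>d\<close> between 1 and
  \<open>c\<close>, does not collapse the ray, because no \<open>n\<close> copies of
  \<open>x\<close> lie below \<open>Y (n c)\<close>. The gauge of a maximal admissible extension
  then satisfies \<open>\<mu> (Y 1) \<le> 1 < d \<le> \<mu> x\<close>.\<close>

lemma separating_state: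
  assumes c: "1 < c" and K: "x \<le> Y K" "0 \<le> K"
    and x: "\<And>n. 0 < n \<Longrightarrow> \<not> nsum n x \<le> Y (real n * c)"
  obtains \<mu> :: "'b \<Rightarrow> ennreal" where "ordered_semigroup_map \<mu>" "\<mu> (Y 1) < \<mu> x"
proof -
  \<comment> \<open>The gap from 1 to \<open>d\<close> gives strict separation; the gap from
    \<open>d\<close> to \<open>c\<close> absorbs the constant \<open>q\<close> below.\<close>
  define d where "d = (1 + c) / 2"
  have d: "1 < d" "d < c"
    using c by (auto simp: d_def field_simps)
  define R0 where "R0 = adjoin {(a, b). a \<le> b} (Y d) x"
  have cp: "cone_preorder {(a, b :: 'b). a \<le> b}"
    by (auto simp: cone_preorder_def trans_def intro: add_right_mono)
  have "(Y r, Y q) \<notin> R0" if q: "0 \<le> q" "q < r" for r q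
  proof
    assume "(Y r, Y q) \<in> R0"
    then obtain k where k: "Y r + nsum k x \<le> Y q + nsum k (Y d)"
      by (auto simp: R0_def adjoin_def)
    have "Y r = Y q + Y (r - q)"
      using ray_add[of q "r - q"] q by simp
    with k have "Y q + (Y (r - q) + nsum k x) \<le> Y q + nsum k (Y d)"
      by (simp add: ac_simps)
    then have "Y q + nsum n (Y (r - q) + nsum k x) \<le> Y q + nsum n (nsum k (Y d))" for n
      using cone_preorder_iterate[OF cp, of "Y q" "Y (r - q) + nsum k x" "nsum k (Y d)" n] by simp
    then have it: "Y q + (Y (real n * (r - q)) + nsum (n * k) x) \<le> Y (q + real n * (real k * d))" for n
      using q d by (simp add: nsum_add_right nsum_mult nsum_ray ray_add)
    show False
    proof (cases "k = 0")
      case True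
      \<comment> \<open>Here the given order itself collapses the ray: \<open>Y q\<close> dominates
        every \<open>Y (n (r - q))\<close>, hence every multiple of \<open>x\<close>. Any
        \<open>N\<close> with \<open>N c > q\<close> then gives the forbidden
        \<open>N x \<le> Y (N c)\<close>.\<close>
      obtain N :: nat where N: "q / c < real N"
        using reals_Archimedean2 by blast
      then have N0: "0 < N"
        using q(1) c by (metis divide_nonneg_pos le_less_trans less_trans of_nat_0_less_iff zero_less_one)
      obtain n :: nat where n: "real N * K / (r - q) < real n"
        using reals_Archimedean2 by blast
      have "nsum N x \<le> Y (real N * K)"
        using nsum_mono[OF K(1), of N] K(2) by (simp add: nsum_ray)
      also have "\<dots> \<le> Y (real n * (r - q))"
        using n q K(2) by (intro ray_mono) (auto simp: field_simps)
      also have "\<dots> \<le> Y q + Y (real n * (r - q))"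
        using add_right_mono[OF ordered_semigroup_zero_least, of "Y (real n * (r - q))" "Y q"] by simp
      also have "\<dots> \<le> Y q"
        using it[of n] True by simp
      also have "\<dots> \<le> Y (real N * c)"
        using N q(1) c by (intro ray_mono) (auto simp: field_simps)
      finally show False
        using x[OF N0] by simp
    next
      case False
      \<comment> \<open>Chosen so that \<open>q + n k d \<le> n k c\<close>, which puts
        \<open>n k\<close> copies of \<open>x\<close> below \<open>Y (n k c)\<close>.\<close>
      obtain n :: nat where n: "q / (real k * (c - d)) < real n"
        using reals_Archimedean2 by blast
      have "0 \<le> q / (real k * (c - d))"
        using q(1) d by simp
      then have n0: "0 < n"
        using n by (metis le_less_trans of_nat_0_less_iff)
      have "nsum (n * k) x \<le> Y q + (Y (real n * (r - q)) + nsum (n * k) x)"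
        by (metis add.assoc add_0 add_right_mono ordered_semigroup_zero_least)
      also have "\<dots> \<le> Y (q + real n * (real k * d))"
        by (rule it)
      also have "\<dots> \<le> Y (real (n * k) * c)"
        using n q(1) d False by (intro ray_mono) (auto simp: field_simps)
      finally show False
        using x[of "n * k"] n0 False by simp
    qed
  qed
  then have "admissible R0"
    using cone_preorder_adjoin[OF cp] by (simp add: admissible_def R0_def)
  then obtain R where R: "admissible R" "R0 \<subseteq> R" "\<And>R'. admissible R' \<Longrightarrow> R \<subseteq> R' \<Longrightarrow> R' = R"
    using admissible_maximal_exists by blast
  define \<mu> where "\<mu> = (\<lambda>a. Inf {ennreal r | r. 0 \<le> r \<and> (a, Y r) \<in> R})"
  have cpR: "cone_preorder R"
    using R(1) by (simp add: admissible_def)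
  note cpD = cone_preorderD[OF cpR]
  have "\<mu> (Y 1) \<le> ennreal 1"
    unfolding \<mu>_def using cpD(1)[of "Y 1" "Y 1"] by (intro Inf_lower) (auto intro!: exI[of _ 1])
  also have "ennreal 1 < ennreal d"
    using d by (simp add: ennreal_lessI)
  also have "ennreal d \<le> \<mu> x"
    unfolding \<mu>_def
  proof (rule Inf_greatest)
    fix u assume "u \<in> {ennreal r | r. 0 \<le> r \<and> (x, Y r) \<in> R}"
    then obtain r where r: "u = ennreal r" "0 \<le> r" "(x, Y r) \<in> R"
      by blast
    have "(Y d, x) \<in> R"
      using R(2) adjoin_extends(2)[OF cp] unfolding R0_def by blast
    then have "(Y d, Y r) \<in> R"
      using cpD(2) r(3) by blast
    then have "d \<le> r"
      using R(1) r(2) unfolding admissible_def by (meson not_le)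
    then show "ennreal d \<le> u"
      using r by (simp add: ennreal_leI)
  qed
  finally show ?thesis
    using that[of \<mu>] maximal_admissible_gauge[OF R(1,3)] unfolding \<mu>_def by blast
qed

end

section \<open>Real multiplication and detection of the order by functionals\<close>

lemma real_multiplicationD:
  assumes "real_multiplication m"
  shows "0 < t \<Longrightarrow> 0 < u \<Longrightarrow> m (t + u) s = m t s + m u s"
    and "0 < t \<Longrightarrow> m t (a + b) = m t a + m t b"
    and "0 < t \<Longrightarrow> a \<le> b \<Longrightarrow> m t a \<le> m t b"
    and "incseq T \<Longrightarrow> (\<And>n. 0 < T n) \<Longrightarrow> is_seq_sup (\<lambda>n. m (T n) s) (m (SUP n. T n) s)"
    and "m 1 s = s"
  using assms by (simp_all add: real_multiplication_def)

text \<open>The inductions start at one copy, since \<open>real_multiplication\<close> does not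
  prescribe \<open>m 0 s\<close> or \<open>m t 0\<close>.\<close>

lemma real_multiplication_nsum:
  assumes m: "real_multiplication m" and t: "0 < t" and n: "0 < n"
  shows "nsum n (m t s) = m (of_nat n * t) s" "nsum n (m t s) = m t (nsum n s)"
proof -
  obtain k where k: "n = Suc k"
    using n by (cases n) auto
  have "nsum (Suc k) (m t s) = m (of_nat (Suc k) * t) s"
  proof (induction k)
    case (Suc k)
    have "0 < of_nat (Suc k) * t"
      using t by (metis ennreal_zero_less_mult_iff of_nat_0_less_iff zero_less_Suc)
    then have "m (t + of_nat (Suc k) * t) s = m t s + m (of_nat (Suc k) * t) s"
      by (rule real_multiplicationD(1)[OF m t])
    then show ?case
      using Suc real_multiplicationD(5)[OF m] by (simp add: distrib_right)
  qed (simp add: real_multiplicationD(5)[OF m])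
  then show "nsum n (m t s) = m (of_nat n * t) s"
    using k by simp
  have "nsum (Suc k) (m t s) = m t (nsum (Suc k) s)"
  proof (induction k)
    case (Suc k)
    have "m t (s + nsum (Suc k) s) = m t s + m t (nsum (Suc k) s)"
      by (rule real_multiplicationD(2)[OF m t])
    then show ?case
      using Suc by simp
  qed simp
  then show "nsum n (m t s) = m t (nsum n s)"
    using k by simp
qed

lemma real_multiplication_fraction:
  assumes m: "real_multiplication m" and n: "0 < n" and k: "0 < k"
  shows "m (ennreal (1 / real n)) (nsum k s) = m (ennreal (real k / real n)) s"
proof -
  have t: "0 < ennreal (1 / real n)"
    using n by simp
  have "of_nat k * ennreal (1 / real n) = ennreal (real k / real n)"
    by (simp add: ennreal_of_nat_eq_real_of_nat ennreal_mult[symmetric])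
  then show ?thesis
    using real_multiplication_nsum[OF m t k, of s] by simp
qed

lemma nsum_real_multiplication_inverse:
  assumes m: "real_multiplication m" and n: "0 < n"
  shows "nsum n (m (ennreal (1 / real n)) s) = s"
  using real_multiplication_nsum(2)[OF m _ n, of "ennreal (1 / real n)" s]
    real_multiplication_fraction[OF m n n, of s] m n
  by (simp add: real_multiplicationD(5))

text \<open>A failure of \<open>x \<le> y\<close> passes to some \<open>x'\<close> way below
  \<open>x\<close>. It suffices to separate \<open>x'\<close> from \<open>y\<close> by an additive
  monotone map, since the way-below gap pays for regularizing it. Whether the ray of
  \<open>y\<close> bounds \<open>x'\<close> decides which map is used.\<close>

lemma le_if_functional_le:
  fixes x y :: "'b::ordered_semigroup"
  assumes ax: "axioms_O1_O5 TYPE('b)" and "has_real_multiplication TYPE('b)"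
    and le: "\<And>l. functional_apply l x \<le> functional_apply l y"
  shows "x \<le> y"
proof (rule ccontr)
  assume neg: "\<not> x \<le> y"
  obtain m :: "ennreal \<Rightarrow> 'b \<Rightarrow> 'b" where m: "real_multiplication m"
    using assms(2) unfolding has_real_multiplication_def by blast
  obtain xs where xs: "is_seq_sup xs x" "\<And>n. xs n \<lless> x"
    using axiom_O2E[of x] ax unfolding axioms_O1_O5_def by metis
  then obtain i where "\<not> xs i \<le> y"
    using is_seq_sup_least neg by blast
  then obtain x' where x': "x' \<lless> x" "\<not> x' \<le> y"
    using xs(2) by blast
  \<comment> \<open>Regularizing \<open>\<mu>\<close> to a functional \<open>l\<close> gives the
    chain \<open>\<mu> x' \<le> l x \<le> l y \<le> \<mu> y\<close>.\<close>
  have no_state: "\<mu> x' \<le> \<mu> y" if \<mu>: "ordered_semigroup_map \<mu>" for \<mu> :: "'b \<Rightarrow> ennreal"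
  proof -
    obtain l where "\<And>s. functional_apply l s \<le> \<mu> s"
      "\<And>s' s. s' \<lless> s \<Longrightarrow> \<mu> s' \<le> functional_apply l s"
      using functional_regularization[OF ax \<mu>] by blast
    then show ?thesis
      using le[of l] x'(1) by (meson order_trans)
  qed
  \<comment> \<open>These scalars increase to 1, so by continuity in the scalar some
    \<open>m (t j) x'\<close> still fails to lie below \<open>y\<close>. This is the strict margin
    that separation requires.\<close>
  define t where "t j = ennreal (real (Suc j) / real (Suc (Suc j)))" for j
  have t_pos: "0 < t j" for j
    by (simp add: t_def)
  have t_inc: "incseq t"
    unfolding t_def by (intro incseq_SucI ennreal_leI) (simp add: divide_simps, simp add: algebra_simps)
  have "t \<longlonglongrightarrow> ennreal 1"
    unfolding t_def using LIMSEQ_Suc[OF LIMSEQ_n_over_Suc_n[where 'a=real]]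
    by (intro tendsto_ennrealI) (simp add: field_simps)
  then have t_sup: "(SUP j. t j) = 1"
    using LIMSEQ_SUP[OF t_inc] LIMSEQ_unique by fastforce
  have "is_seq_sup (\<lambda>j. m (t j) x') x'"
    using real_multiplicationD(4)[OF m t_inc t_pos, of x'] real_multiplicationD(5)[OF m]
    by (simp add: t_sup)
  then obtain j where j: "\<not> m (t j) x' \<le> y"
    using x'(2) is_seq_sup_least by blast
  \<comment> \<open>The value at 0 is set by hand because \<open>m 0\<close> is arbitrary.\<close>
  define Y where "Y r = (if 0 < r then m (ennreal r) y else 0)" for r
  interpret ray Y
  proof
    show "Y 0 = 0"
      by (simp add: Y_def)
    show "Y (r + q) = Y r + Y q" if "0 \<le> r" "0 \<le> q" for r q
    proof (cases "r = 0 \<or> q = 0")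
      case False
      then have "0 < ennreal r" "0 < ennreal q" "ennreal (r + q) = ennreal r + ennreal q"
        using that by auto
      then show ?thesis
        using that False real_multiplicationD(1)[OF m, of "ennreal r" "ennreal q" y]
        by (simp add: Y_def)
    qed (auto simp: Y_def)
  qed
  have Y1: "Y 1 = y"
    by (simp add: Y_def real_multiplicationD(5)[OF m])
  show False
  proof (cases "\<exists>K\<ge>0. x' \<le> Y K")
    case True
    then obtain K where K: "x' \<le> Y K" "0 \<le> K"
      by blast
    \<comment> \<open>The reciprocal of \<open>t j\<close>. A relation
      \<open>n x' \<le> n c y\<close>, multiplied by \<open>j + 1\<close> and divided by
      \<open>n (j + 2)\<close>, would give \<open>m (t j) x' \<le> y\<close>.\<close>
    define c where "c = real (Suc (Suc j)) / real (Suc j)"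
    have "1 < c"
      by (simp add: c_def)
    moreover have "\<not> nsum n x' \<le> Y (real n * c)" if n: "0 < n" for n
    proof
      assume "nsum n x' \<le> Y (real n * c)"
      then have "nsum (Suc j) (nsum n x') \<le> nsum (Suc j) (Y (real n * c))"
        by (rule nsum_mono)
      also have "\<dots> = Y (real (n * Suc (Suc j)) * 1)"
      proof -
        have "real (Suc j) * (real n * c) = real (n * Suc (Suc j)) * 1"
          by (simp add: c_def field_simps)
        then show ?thesis
          using nsum_ray[of "real n * c" "Suc j"] \<open>1 < c\<close> by simp
      qed
      also have "\<dots> = nsum (n * Suc (Suc j)) y"
        by (subst nsum_ray[symmetric]) (simp_all add: Y1)
      finally have le_n: "nsum (n * Suc j) x' \<le> nsum (n * Suc (Suc j)) y"
        by (simp only: nsum_mult[symmetric] mult.commute)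
      define M where "M = n * Suc (Suc j)"
      have pos: "0 < M" "0 < n * Suc j"
        using n by (simp_all add: M_def)
      have "m (ennreal (1 / real M)) (nsum (n * Suc j) x')
          \<le> m (ennreal (1 / real M)) (nsum M y)"
      proof -
        have "0 < ennreal (1 / real M)"
          using pos(1) by simp
        then show ?thesis
          using le_n[folded M_def] by (rule real_multiplicationD(3)[OF m])
      qed
      then have "m (ennreal (real (n * Suc j) / real M)) x' \<le> m (ennreal (real M / real M)) y"
        by (simp only: real_multiplication_fraction[OF m pos(1)] pos)
      moreover have "ennreal (real (n * Suc j) / real M) = t j"
        using n unfolding t_def M_def by (simp only: of_nat_mult) simp
      moreover have "m (ennreal (real M / real M)) y = y"
      proof -
        have "real M / real M = 1"
          using pos(1) by (simp only: divide_self of_nat_0_eq_iff)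
        then show ?thesis
          by (simp only: ennreal_1 real_multiplicationD(5)[OF m])
      qed
      ultimately show False
        using j by simp
    qed
    ultimately obtain \<mu> :: "'b \<Rightarrow> ennreal" where "ordered_semigroup_map \<mu>" "\<mu> (Y 1) < \<mu> x'"
      using separating_state[OF _ K] by metis
    then show False
      using no_state[of \<mu>] Y1 by simp
  next
    case False
    \<comment> \<open>The order ideal generated by the ray. A sum lies in it exactly when both
      summands do, which makes the map with values 0 and \<open>top\<close> additive.\<close>
    define I where "I = {z. \<exists>K\<ge>0. z \<le> Y K}"
    have I_add: "a + b \<in> I \<longleftrightarrow> a \<in> I \<and> b \<in> I" for a b
    proof
      assume "a + b \<in> I"
      moreover have "a \<le> a + b" "b \<le> a + b"
        using add_left_mono[OF ordered_semigroup_zero_least, of a b]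
          add_right_mono[OF ordered_semigroup_zero_least, of b a] by simp_all
      ultimately show "a \<in> I \<and> b \<in> I"
        unfolding I_def by (blast intro: order_trans)
    next
      assume "a \<in> I \<and> b \<in> I"
      then obtain K L where "0 \<le> K" "a \<le> Y K" "0 \<le> L" "b \<le> Y L"
        unfolding I_def by blast
      then have "0 \<le> K + L" "a + b \<le> Y (K + L)"
        by (auto simp: ray_add intro: add_mono)
      then show "a + b \<in> I"
        unfolding I_def by blast
    qed
    have "ordered_semigroup_map (\<lambda>z. if z \<in> I then 0 else top :: ennreal)"
      unfolding ordered_semigroup_map_def
    proof (intro conjI monoI allI)
      fix a b :: 'b assume "a \<le> b"
      then have "b \<in> I \<Longrightarrow> a \<in> I"
        unfolding I_def by (blast intro: order_trans)
      then show "(if a \<in> I then 0 else top :: ennreal) \<le> (if b \<in> I then 0 else top)"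
        by auto
    next
      have "0 \<in> I"
        unfolding I_def using ray_zero by auto
      then show "(if 0 \<in> I then 0 else top :: ennreal) = 0"
        by simp
    qed (auto simp: I_add)
    moreover have "y \<in> I" "x' \<notin> I"
      using False Y1 unfolding I_def by (auto intro!: exI[of _ "1::real"])
    ultimately show False
      using no_state by fastforce
  qed
qed

section \<open>Compactness and uniform comparison on the cone of functionals\<close>

lemma compact_UNIV_fun_ennreal: "compact (UNIV :: ('a \<Rightarrow> ennreal) set)"
proof -
  have "compact_space (product_topology (\<lambda>_::'a. euclidean :: ennreal topology) UNIV)"
    using compact_UNIV[where 'a=ennreal] by (simp add: compact_space_product_topology) (simp add: compact_space_def)
  then show ?thesis
    by (simp add: euclidean_product_topology compact_space_def)
qed

lemma ordered_semigroup_map_scale: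
  fixes \<mu> :: "'a::ordered_semigroup \<Rightarrow> ennreal"
  shows "ordered_semigroup_map \<mu> \<Longrightarrow> ordered_semigroup_map (\<lambda>s. e * \<mu> s)"
  by (auto simp: ordered_semigroup_map_def mono_def distrib_left mult_left_mono)

text \<open>A Dini type argument: an inequality against an increasing supremum holds at a single
  index for all functionals, after losing a way-below step and the factor \<open>c\<close>.
  Otherwise the normalized counterexamples yield, by compactness, one additive monotone map in all
  \<open>C i\<close>, whose regularization violates \<open>le\<close>.\<close>

lemma functional_way_below_compactness:
  fixes s s' :: "'a::ordered_semigroup" and a :: "nat \<Rightarrow> real"
  assumes ax: "axioms_O1_O5 TYPE('a)" and s: "s' \<lless> s" and c: "c < 1"
    and inc: "\<And>l. incseq (\<lambda>j. ennreal (a j) * functional_apply l (t j))"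
    and le: "\<And>l. functional_apply l s \<le> (SUP j. ennreal (a j) * functional_apply l (t j))"
  obtains j where "\<And>l. c * functional_apply l s' \<le> ennreal (a j) * functional_apply l (t j)"
proof (rule ccontr)
  assume no: "\<not> thesis"
  \<comment> \<open>Only additivity and monotonicity are demanded, as these are closed conditions in
    the product topology; preservation of suprema need not pass to limits.\<close>
  define C where "C i = {\<mu> :: 'a \<Rightarrow> ennreal. ordered_semigroup_map \<mu> \<and> 1 \<le> \<mu> s' \<and> ennreal (a i) * \<mu> (t i) \<le> c}"
    for i
  have nested: "\<exists>\<mu>. \<forall>i\<le>j. \<mu> \<in> C i" for j
  proof -
    have "\<not> (\<forall>l. c * functional_apply l s' \<le> ennreal (a j) * functional_apply l (t j))"
      using no that by blast
    then obtain l where l: "ennreal (a j) * functional_apply l (t j) < c * functional_apply l s'"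
      by (auto simp: not_le)
    define u where "u = ennreal (a j) * functional_apply l (t j)"
    \<comment> \<open>For \<open>u = 0\<close> the factor \<open>c / u\<close> is
      \<open>top\<close>, because \<open>l\<close> forces \<open>c\<close> to be nonzero;
      \<open>\<mu>\<close> then has only the values 0 and \<open>top\<close>, and both bounds still
      hold.\<close>
    define \<mu> where "\<mu> = (\<lambda>r. c / u * functional_apply l r)"
    have "ordered_semigroup_map \<mu>"
      unfolding \<mu>_def using functional_apply[of l] by (intro ordered_semigroup_map_scale) auto
    moreover have "1 \<le> \<mu> s'"
    proof (cases "u = 0")
      case True
      then show ?thesis
        using l unfolding u_def[symmetric] \<mu>_def
        by (auto simp: ennreal_zero_less_mult_iff ennreal_divide_zero ennreal_top_mult)
    next
      case False
      have "u < top"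
        using l unfolding u_def[symmetric] by (meson less_le_trans top_greatest)
      then have "1 = u / u"
        using False by (simp add: ennreal_divide_self)
      also have "\<dots> \<le> (c * functional_apply l s') / u"
        using l unfolding u_def[symmetric] by (intro divide_right_mono_ennreal) simp
      finally show ?thesis
        by (simp add: \<mu>_def ennreal_divide_times ennreal_times_divide mult.commute)
    qed
    moreover have "ennreal (a i) * \<mu> (t i) \<le> c" if "i \<le> j" for i
    proof -
      have "ennreal (a i) * functional_apply l (t i) \<le> u"
        unfolding u_def using incseqD[OF inc that] .
      then have "ennreal (a i) * \<mu> (t i) \<le> c / u * u"
        unfolding \<mu>_def by (subst mult.left_commute) (rule mult_left_mono, simp_all)
      also have "\<dots> \<le> c"
      proof (cases "u = 0")
        case False
        have "u < top"
          using l unfolding u_def[symmetric] by (meson less_le_trans top_greatest)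
        with False show ?thesis
          by (simp add: ennreal_divide_times ennreal_mult_divide_eq)
      qed simp
      finally show ?thesis .
    qed
    ultimately show ?thesis
      unfolding C_def by blast
  qed
  have cont: "continuous_on UNIV (\<lambda>\<mu> :: 'a \<Rightarrow> ennreal. \<mu> r)" for r
    by (rule continuous_on_product_coordinates)
  have "closed (C i)" for i
  proof -
    have "C i = {\<mu>. \<forall>p q. p \<le> q \<longrightarrow> \<mu> p \<le> \<mu> q} \<inter> {\<mu>. \<forall>p q. \<mu> (p + q) = \<mu> p + \<mu> q} \<inter>
        {\<mu>. \<mu> 0 = 0} \<inter> {\<mu>. 1 \<le> \<mu> s'} \<inter> {\<mu>. ennreal (a i) * \<mu> (t i) \<le> c}"
      by (auto simp: C_def ordered_semigroup_map_def mono_def)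
    also have "closed \<dots>"
      by (intro closed_Int closed_Collect_all closed_Collect_imp closed_Collect_le closed_Collect_eq
          cont continuous_intros open_Collect_const ennreal_continuous_on_cmult) simp_all
    finally show ?thesis .
  qed
  then have "UNIV \<inter> (\<Inter>i\<in>UNIV. C i) \<noteq> {}"
  proof (rule compact_imp_fip_image[OF compact_UNIV_fun_ennreal])
    fix J :: "nat set" assume "finite J"
    then obtain j where "\<forall>i\<in>J. i \<le> j"
      using finite_nat_set_iff_bounded_le by blast
    then show "UNIV \<inter> (\<Inter>i\<in>J. C i) \<noteq> {}"
      using nested[of j] by blast
  qed
  then obtain \<mu> where \<mu>: "\<And>i. \<mu> \<in> C i"
    by blast
  obtain l where l: "\<And>s. functional_apply l s \<le> \<mu> s"
      "\<And>s' s. s' \<lless> s \<Longrightarrow> \<mu> s' \<le> functional_apply l s"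
    using functional_regularization[OF ax] \<mu>[of 0] unfolding C_def by blast
  have "1 \<le> functional_apply l s"
    using \<mu>[of 0] l(2)[OF s] unfolding C_def by auto
  also have "\<dots> \<le> (SUP j. ennreal (a j) * functional_apply l (t j))"
    by (rule le)
  also have "\<dots> \<le> c"
  proof (rule SUP_least)
    fix j
    have "ennreal (a j) * functional_apply l (t j) \<le> ennreal (a j) * \<mu> (t j)"
      by (intro mult_left_mono l(1)) simp
    also have "\<dots> \<le> c"
      using \<mu>[of j] unfolding C_def by blast
    finally show "ennreal (a j) * functional_apply l (t j) \<le> c" .
  qed
  finally show False
    using c by simp
qed

text \<open>Dividing all scalars by \<open>r\<close> reduces this to
  \<open>functional_way_below_compactness\<close> with factor \<open>q / r\<close>.\<close>

lemma functional_way_below_scaled: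
  fixes s s' :: "'a::ordered_semigroup" and a :: "nat \<Rightarrow> real"
  assumes ax: "axioms_O1_O5 TYPE('a)" and s: "s' \<lless> s" and q: "0 < q" "q < r"
    and a: "\<And>j. 0 < a j" and inc: "\<And>l. incseq (\<lambda>j. ennreal (a j) * functional_apply l (t j))"
    and le: "\<And>l. ennreal r * functional_apply l s \<le> (SUP j. ennreal (a j) * functional_apply l (t j))"
  obtains j where "\<And>l. ennreal q * functional_apply l s' \<le> ennreal (a j) * functional_apply l (t j)"
proof -
  have r: "0 < r"
    using q by simp
  have div: "ennreal (u / r) * v = ennreal (1 / r) * (ennreal u * v)" if "0 < u" for u v
    using that r by (simp add: ennreal_mult[symmetric] mult.assoc[symmetric])
  have "ennreal (q / r) < 1"
    using q by (simp add: ennreal_less_one_iff)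
  moreover have "incseq (\<lambda>j. ennreal (a j / r) * functional_apply l (t j))" for l
    using inc[of l] by (auto simp: div[OF a] mono_def mult_left_mono)
  moreover have "functional_apply l s \<le> (SUP j. ennreal (a j / r) * functional_apply l (t j))" for l
  proof -
    have "functional_apply l s = ennreal (1 / r) * (ennreal r * functional_apply l s)"
      using r div[OF r, symmetric] by simp
    also have "\<dots> \<le> ennreal (1 / r) * (SUP j. ennreal (a j) * functional_apply l (t j))"
      by (intro mult_left_mono le) simp
    also have "\<dots> = (SUP j. ennreal (a j / r) * functional_apply l (t j))"
      by (simp add: SUP_mult_left_ennreal div[OF a])
    finally show ?thesis .
  qed
  ultimately obtain j where
    j: "\<And>l. ennreal (q / r) * functional_apply l s' \<le> ennreal (a j / r) * functional_apply l (t j)"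
    using functional_way_below_compactness[OF ax s, of "ennreal (q / r)" "\<lambda>j. a j / r" t] by metis
  have "ennreal q * functional_apply l s' \<le> ennreal (a j) * functional_apply l (t j)" for l
  proof -
    have mul: "ennreal r * (ennreal (u / r) * v) = ennreal u * v" if "0 < u" for u v
      using that r by (simp add: ennreal_mult[symmetric] mult.assoc[symmetric])
    show ?thesis
      using mult_left_mono[OF j[of l], of "ennreal r"] by (simp add: mul q a)
  qed
  then show ?thesis
    using that by blast
qed

section \<open>Increasing suprema in the realification\<close>

lemma SUP_mult_incseq_ennreal:
  fixes u v :: "nat \<Rightarrow> ennreal"
  assumes "incseq u" "incseq v"
  shows "(SUP j. u j * v j) = (SUP j. u j) * (SUP j. v j)"
proof (rule antisym)
  show "(SUP j. u j * v j) \<le> (SUP j. u j) * (SUP j. v j)"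
    by (auto intro!: SUP_least mult_mono SUP_upper)
  have "u i * v j \<le> (SUP j. u j * v j)" for i j
  proof -
    have "u i * v j \<le> u (max i j) * v (max i j)"
      using assms by (intro mult_mono) (auto simp: mono_def)
    also have "\<dots> \<le> (SUP j. u j * v j)"
      by (rule SUP_upper) simp
    finally show ?thesis .
  qed
  then show "(SUP j. u j) * (SUP j. v j) \<le> (SUP j. u j * v j)"
    by (simp add: SUP_mult_left_ennreal SUP_mult_right_ennreal SUP_le_iff)
qed

lemma divide_of_nat_ennreal: "0 < n \<Longrightarrow> (x::ennreal) / of_nat n = ennreal (1 / real n) * x"
  by (simp add: divide_ennreal_def ennreal_of_nat_eq_real_of_nat inverse_ennreal mult.commute
      inverse_eq_divide)

lemma realification_setD:
  assumes "f \<in> realification_set"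
  shows "\<exists>(s :: nat \<Rightarrow> 'a::ordered_semigroup) (n :: nat \<Rightarrow> nat). (\<forall>i. 0 < n i) \<and>
    incseq (\<lambda>i l. hat (s i) l / of_nat (n i)) \<and> (\<forall>l. f l = (SUP i. hat (s i) l / of_nat (n i)))"
  using assms unfolding realification_set_def by (elim CollectE conjE)

text \<open>The approximations \<open>b k i j\<close> of all the \<open>F k\<close> form a countable
  family with the right pointwise supremum. Compactness makes this family upward directed, so an
  increasing cofinal sequence in it represents the limit.\<close>

lemma SUP_in_realification_set:
  fixes F :: "nat \<Rightarrow> 'a::ordered_semigroup functional \<Rightarrow> ennreal"
  assumes ax: "axioms_O1_O5 TYPE('a)" and F: "\<And>k. F k \<in> realification_set" and "incseq F"
  shows "(\<lambda>l. SUP k. F k l) \<in> realification_set"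
proof -
  define rep where "rep f s n \<longleftrightarrow> (\<forall>i. 0 < n i) \<and> incseq (\<lambda>i l. hat (s i) l / of_nat (n i)) \<and>
    (\<forall>l. f l = (SUP i. hat (s i) l / of_nat (n i)))"
    for f and s :: "nat \<Rightarrow> 'a" and n :: "nat \<Rightarrow> nat"
  have "\<exists>s n. rep (F k) s n" for k
    using realification_setD[OF F[of k]] by (simp only: rep_def)
  then obtain S N where "\<And>k. rep (F k) (S k) (N k)"
    by metis
  then have N: "\<And>k i. 0 < N k i"
    and inc: "\<And>k. incseq (\<lambda>i l. hat (S k i) l / of_nat (N k i))"
    and F_eq: "\<And>k l. F k l = (SUP i. hat (S k i) l / of_nat (N k i))"
    by (auto simp: rep_def)
  have O2: "axiom_O2 TYPE('a)"
    using ax by (simp add: axioms_O1_O5_def)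
  have "\<exists>x. incseq x \<and> is_seq_sup x s \<and> (\<forall>n. x n \<lless> x (Suc n))" for s :: 'a
    by (rule axiom_O2E[OF O2, of s]) blast
  then obtain X :: "'a \<Rightarrow> nat \<Rightarrow> 'a" where X: "\<And>s. incseq (X s)" "\<And>s. is_seq_sup (X s) s"
    "\<And>s n. X s n \<lless> X s (Suc n)"
    by metis
  define g where "g k i l = ennreal (1 / real (N k i)) * functional_apply l (S k i)" for k i l
  have g_inc: "incseq (\<lambda>i. g k i l)" for k l
    using inc[of k] by (simp add: g_def hat_def divide_of_nat_ennreal[OF N] mono_def le_fun_def)
  have F_g: "F k l = (SUP i. g k i l)" for k l
    by (simp add: F_eq g_def hat_def divide_of_nat_ennreal[OF N])
  \<comment> \<open>The factors increase strictly to 1, so each step from \<open>j\<close> to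
    \<open>j + 1\<close> provides a scalar gap along with a way-below step of \<open>X\<close>, as
    \<open>functional_way_below_scaled\<close> requires.\<close>
  define c where "c j = real (Suc j) / real (Suc (Suc j))" for j
  have c: "0 < c j" "c j < c (Suc j)" for j
    by (simp_all add: c_def divide_simps, simp add: algebra_simps)
  have c_inc: "incseq (\<lambda>j. ennreal (c j))"
    by (intro incseq_SucI ennreal_leI less_imp_le c)
  have "(\<lambda>j. ennreal (c j)) \<longlonglongrightarrow> ennreal 1"
    unfolding c_def using LIMSEQ_Suc[OF LIMSEQ_n_over_Suc_n[where 'a=real]]
    by (intro tendsto_ennrealI) (simp add: field_simps)
  then have c_sup: "(SUP j. ennreal (c j)) = 1"
    using LIMSEQ_SUP[OF c_inc] LIMSEQ_unique by fastforce
  define a where "a k i j = c j / real (N k i)" for k i j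
  have a: "0 < a k i j" "a k i j < a k i (Suc j)" for k i j
    using c N by (auto simp: a_def divide_strict_right_mono)
  define b where "b k i j l = ennreal (a k i j) * functional_apply l (X (S k i) j)" for k i j l
  have b_inc: "incseq (\<lambda>j. b k i j l)" for k i l
    unfolding b_def using a X(1)
    by (intro incseq_SucI mult_mono ennreal_leI functional_mono) (auto simp: less_imp_le incseq_SucD)
  have b_sup: "(SUP j. b k i j l) = g k i l" for k i l
  proof -
    have "b k i j l = ennreal (1 / real (N k i)) * (ennreal (c j) * functional_apply l (X (S k i) j))" for j
      using c(1)[of j] by (simp add: b_def a_def ennreal_mult[symmetric] mult.assoc[symmetric])
    moreover have "(SUP j. ennreal (c j) * functional_apply l (X (S k i) j)) = functional_apply l (S k i)"
      using SUP_mult_incseq_ennreal[OF c_inc, of "\<lambda>j. functional_apply l (X (S k i) j)"]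
        X(1)[of "S k i"] functional_SUP[OF X(1,2), symmetric, of l "S k i"]
      by (simp add: c_sup mono_def functional_mono)
    ultimately show ?thesis
      by (simp add: g_def SUP_mult_left_ennreal[symmetric])
  qed
  have b_le: "b k i j l \<le> F K l" if "k \<le> K" for k i j K l
  proof -
    have "b k i j l \<le> g k i l"
      unfolding b_sup[symmetric] by (rule SUP_upper) simp
    also have "\<dots> \<le> F k l"
      unfolding F_g by (rule SUP_upper) simp
    also have "\<dots> \<le> F K l"
      using \<open>incseq F\<close> that by (simp add: mono_def le_fun_def)
    finally show ?thesis .
  qed
  \<comment> \<open>Two steps in \<open>j\<close> are spent: one to replace the supremum
    \<open>F K\<close> by a single \<open>g K I0\<close>, one to replace \<open>g K I\<close> by a
    single \<open>b K I J0\<close>. The bound holds for all large \<open>I\<close> and then all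
    large \<open>J\<close>, so that two indices can be dominated at once.\<close>
  have dominate: "\<exists>I0. \<forall>I\<ge>I0. \<exists>J0. \<forall>J\<ge>J0. \<forall>l. b k i j l \<le> b K I J l" if kK: "k \<le> K" for k i j K
  proof -
    obtain I0 where I0: "\<And>l. b k i (Suc j) l \<le> g K I0 l"
      using functional_way_below_scaled[OF ax X(3)[of "S k i" "Suc j"] a(1) a(2)[of k i "Suc j"],
          of "\<lambda>I. 1 / real (N K I)" "S K"] g_inc[of K] b_le[OF kK, of i "Suc (Suc j)"] N
      unfolding F_g by (auto simp: g_def b_def)
    have "\<exists>J0. \<forall>J\<ge>J0. \<forall>l. b k i j l \<le> b K I J l" if "I0 \<le> I" for I
    proof -
      have "b k i (Suc j) l \<le> (SUP J. b K I J l)" for l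
        using order_trans[OF I0 incseqD[OF g_inc that]] by (simp add: b_sup)
      then obtain J0 where "\<And>l. b k i j l \<le> b K I J0 l"
        using functional_way_below_scaled[OF ax X(3)[of "S k i" j] a(1) a(2)[of k i j],
            of "a K I" "X (S K I)"] b_inc[of K I] a(1)
        by (auto simp: b_def)
      then show ?thesis
        using incseqD[OF b_inc] by (meson order_trans)
    qed
    then show ?thesis
      by blast
  qed
  define B where "B p l = (case p of (k, i, j) \<Rightarrow> b k i j l)" for p l
  have directed: "\<exists>r. B p \<le> B r \<and> B q \<le> B r" for p q
  proof -
    obtain k i j k' i' j' where pq: "p = (k, i, j)" "q = (k', i', j')"
      by (metis prod.exhaust)
    define K where "K = max k k'"
    obtain I1 where I1: "\<And>I. I \<ge> I1 \<Longrightarrow> \<exists>J0. \<forall>J\<ge>J0. \<forall>l. b k i j l \<le> b K I J l"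
      using dominate[of k K i j] by (auto simp: K_def)
    obtain I2 where I2: "\<And>I. I \<ge> I2 \<Longrightarrow> \<exists>J0. \<forall>J\<ge>J0. \<forall>l. b k' i' j' l \<le> b K I J l"
      using dominate[of k' K i' j'] by (auto simp: K_def)
    obtain J1 where J1: "\<And>J l. J \<ge> J1 \<Longrightarrow> b k i j l \<le> b K (max I1 I2) J l"
      using I1[of "max I1 I2"] by auto
    obtain J2 where J2: "\<And>J l. J \<ge> J2 \<Longrightarrow> b k' i' j' l \<le> b K (max I1 I2) J l"
      using I2[of "max I1 I2"] by auto
    have "B p \<le> B (K, max I1 I2, max J1 J2) \<and> B q \<le> B (K, max I1 I2, max J1 J2)"
      using J1[of "max J1 J2"] J2[of "max J1 J2"] by (simp add: pq B_def le_fun_def)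
    then show ?thesis
      by blast
  qed
  \<comment> \<open>A surjective enumeration of the index triples. The sequence \<open>d\<close>
    chosen next is increasing under \<open>B\<close> and dominates \<open>e n\<close> at stage
    \<open>n\<close>.\<close>
  define e :: "nat \<Rightarrow> nat \<times> nat \<times> nat" where "e = from_nat"
  have "\<exists>d. \<forall>n. B (e n) \<le> B (d n) \<and> B (d n) \<le> B (d (Suc n))"
    by (rule dependent_nat_choice) (use directed in blast)+
  then obtain d where d: "\<And>n. B (e n) \<le> B (d n)" "\<And>n. B (d n) \<le> B (d (Suc n))"
    by blast
  have "\<exists>s m. 0 < m \<and> (\<forall>l. B p l = hat s l / of_nat m)" for p
  proof -
    obtain k i j where p: "p = (k, i, j)"
      by (metis prod.exhaust)
    \<comment> \<open>The scalar equals \<open>(j + 1) / M\<close>; its numerator moves into the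
      element as a multiple, leaving a quotient by a positive integer.\<close>
    define M where "M = Suc (Suc j) * N k i"
    have M: "0 < M"
      using N[of k i] by (simp add: M_def)
    have a_eq: "a k i j = 1 / real M * real (Suc j)"
      unfolding a_def c_def M_def of_nat_mult by simp
    have "ennreal (a k i j) = ennreal (1 / real M) * of_nat (Suc j)"
      unfolding a_eq ennreal_of_nat_eq_real_of_nat by (intro ennreal_mult) auto
    then have "B p l = hat (nsum (Suc j) (X (S k i) j)) l / of_nat M" for l
      by (simp only: divide_of_nat_ennreal[OF M] p B_def b_def prod.case hat_def functional_nsum
          mult.assoc)
    with M show ?thesis
      by blast
  qed
  then obtain s m where sm: "\<And>p. 0 < m p" "\<And>p l. B p l = hat (s p) l / of_nat (m p :: nat)"
    by metis
  show ?thesis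
  proof (rule realification_setI)
    show "0 < m (d n)" for n
      by (rule sm)
    show "incseq (\<lambda>n l. hat (s (d n)) l / of_nat (m (d n)))"
      using d(2) by (simp add: sm(2)[symmetric] incseq_SucI le_fun_def)
    show "(SUP k. F k l) = (SUP n. hat (s (d n)) l / of_nat (m (d n)))" for l
      unfolding sm(2)[symmetric]
    proof (rule antisym)
      have "b k i j l \<le> (SUP n. B (d n) l)" for k i j
      proof -
        have "b k i j l = B (e (to_nat (k, i, j))) l"
          by (simp add: e_def B_def)
        also have "\<dots> \<le> B (d (to_nat (k, i, j))) l"
          using d(1) by (simp add: le_fun_def)
        also have "\<dots> \<le> (SUP n. B (d n) l)"
          by (rule SUP_upper) simp
        finally show ?thesis .
      qed
      then show "(SUP k. F k l) \<le> (SUP n. B (d n) l)"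
        unfolding F_g b_sup[symmetric] by (intro SUP_least)
      have "B p l \<le> (SUP k. F k l)" for p
      proof -
        obtain k i j where "p = (k, i, j)"
          by (metis prod.exhaust)
        then have "B p l \<le> F k l"
          using b_le[OF order_refl] by (simp add: B_def)
        also have "\<dots> \<le> (SUP k. F k l)"
          by (rule SUP_upper) simp
        finally show ?thesis .
      qed
      then show "(SUP n. B (d n) l) \<le> (SUP k. F k l)"
        by (intro SUP_least)
    qed
  qed
qed

text \<open>The pointwise supremum belongs to the realification, so it is an upper bound there and
  the order supremum cannot exceed it.\<close>

lemma realification_apply_seq_sup:
  fixes x :: "nat \<Rightarrow> 'a::ordered_semigroup realification"
  assumes ax: "axioms_O1_O5 TYPE('a)" and x: "incseq x" "is_seq_sup x u"
  shows "realification_apply u l = (SUP n. realification_apply (x n) l)"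
proof (rule antisym)
  define v where "v = Abs_realification (\<lambda>l. SUP n. realification_apply (x n) l)"
  have "incseq (\<lambda>n. realification_apply (x n))"
    using x(1) by (simp add: mono_def less_eq_realification.rep_eq)
  then have v: "realification_apply v = (\<lambda>l. SUP n. realification_apply (x n) l)"
    unfolding v_def by (intro Abs_realification_inverse SUP_in_realification_set ax realification_apply)
  have "x n \<le> v" for n
    unfolding less_eq_realification.rep_eq v by (auto simp: le_fun_def intro: SUP_upper)
  then have "u \<le> v"
    by (rule is_seq_sup_least[OF x(2)])
  then show "realification_apply u l \<le> (SUP n. realification_apply (x n) l)"
    unfolding less_eq_realification.rep_eq v by (simp add: le_fun_def)
  show "(SUP n. realification_apply (x n) l) \<le> realification_apply u l"
    using is_seq_sup_upper[OF x(2)] by (auto simp: less_eq_realification.rep_eq le_fun_def intro: SUP_least)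
qed

section \<open>Existence and uniqueness of the extension\<close>

text \<open>The map of cones dual to \<open>\<alpha>\<close>. The use of
  \<open>Abs_functional\<close> is justified once \<open>\<alpha>\<close> is an ordered semigroup
  map preserving increasing suprema.\<close>

definition pullback :: "('a::ordered_semigroup \<Rightarrow> 'b::ordered_semigroup) \<Rightarrow> 'b functional \<Rightarrow> 'a functional"
  where "pullback \<alpha> l = Abs_functional (\<lambda>s. functional_apply l (\<alpha> s))"

lemma functional_apply_pullback:
  assumes "ordered_semigroup_map \<alpha>" "preserves_seq_sups \<alpha>"
  shows "functional_apply (pullback \<alpha> l) s = functional_apply l (\<alpha> s)"
proof -
  have "ordered_semigroup_map (\<lambda>s. functional_apply l (\<alpha> s))"
    using assms(1) by (auto simp: ordered_semigroup_map_def mono_def functional_mono functional_add functional_zero)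
  moreover have "preserves_seq_sups (\<lambda>s. functional_apply l (\<alpha> s))"
    using assms ordered_semigroup_mapD(1)[OF assms(1)]
    by (auto simp: preserves_seq_sups_ennreal_iff preserves_seq_sups_def mono_def intro!: functional_SUP[symmetric])
  ultimately show ?thesis
    unfolding pullback_def by (simp add: Abs_functional_inverse)
qed

theorem proposition3p1p3:
  fixes \<alpha> :: "'a::ordered_semigroup \<Rightarrow> 'b::ordered_semigroup"
  assumes "axioms_O1_O5 TYPE('a)"
    and "axioms_O1_O5 TYPE('b)"
    and "has_real_multiplication TYPE('b)"
    and "ordered_semigroup_map \<alpha>"
    and "preserves_seq_sups \<alpha>"
  shows "\<exists>!\<beta> :: 'a realification \<Rightarrow> 'b.
    ordered_semigroup_map \<beta> \<and> preserves_seq_sups \<beta> \<and> (\<forall>s. \<beta> (realification_hat s) = \<alpha> s)"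
proof -
  note pb = functional_apply_pullback[OF assms(4,5)]
  note le = le_if_functional_le[OF assms(2,3)]
  have eqI: "x = y" if "\<And>l. functional_apply l x = functional_apply l y" for x y :: 'b
    using that by (intro antisym le) simp_all
  obtain m :: "ennreal \<Rightarrow> 'b \<Rightarrow> 'b" where m: "real_multiplication m"
    using assms(3) unfolding has_real_multiplication_def by blast
  note repr = realification_setD[OF realification_apply]
  have divide: "u / of_nat n = v" if "of_nat n * v = u" "0 < n" for n and u v :: ennreal
    using that by (metis ennreal_mult_divide_eq mult.commute of_nat_eq_0_iff of_nat_less_top
        less_irrefl top.not_eq_extremum)
  have "\<exists>t. \<forall>l. functional_apply l t = realification_apply f (pullback \<alpha> l)" for f
  proof -
    obtain s n where n: "\<And>i. 0 < n i" and inc: "incseq (\<lambda>i l. hat (s i) l / of_nat (n i))"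
      and f: "\<And>l. realification_apply f l = (SUP i. hat (s i) l / of_nat (n i :: nat))"
      using repr[of f] by blast
    \<comment> \<open>The quotients of \<open>\<alpha> (s i)\<close> by \<open>n i\<close>, formed
      in the target. Functionals take on them the increasing values that represent \<open>f\<close>,
      which shows that \<open>x\<close> is increasing.\<close>
    define x where "x i = m (ennreal (1 / real (n i))) (\<alpha> (s i))" for i
    have x: "functional_apply l (x i) = hat (s i) (pullback \<alpha> l) / of_nat (n i)" for l i
    proof -
      have "nsum (n i) (x i) = \<alpha> (s i)"
        unfolding x_def by (rule nsum_real_multiplication_inverse[OF m n])
      then have "of_nat (n i) * functional_apply l (x i) = hat (s i) (pullback \<alpha> l)"
        by (metis functional_nsum pb hat_def)
      then show ?thesis
        using divide n by metis
    qed
    have "incseq x"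
      using inc by (intro monoI le) (simp add: x mono_def le_fun_def)
    then obtain t where "is_seq_sup x t"
      using assms(2) unfolding axioms_O1_O5_def axiom_O1_def by blast
    then have "functional_apply l t = realification_apply f (pullback \<alpha> l)" for l
      using functional_SUP[OF \<open>incseq x\<close>] by (simp add: f x)
    then show ?thesis
      by blast
  qed
  then obtain \<beta> where \<beta>: "\<And>f l. functional_apply l (\<beta> f) = realification_apply f (pullback \<alpha> l)"
    by metis
  show ?thesis
  proof (intro ex1I[of _ \<beta>] conjI)
    show "ordered_semigroup_map \<beta>"
      unfolding ordered_semigroup_map_def
    proof (intro conjI monoI allI)
      show "\<beta> f \<le> \<beta> g" if "f \<le> g" for f g
        using that by (intro le) (simp add: \<beta> less_eq_realification.rep_eq le_fun_def)
    qed (auto intro!: eqI simp: \<beta> functional_add functional_zero plus_realification.rep_eq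
        zero_realification.rep_eq)
    then have mono: "\<beta> f \<le> \<beta> g" if "f \<le> g" for f g
      using that by (rule ordered_semigroup_mapD(1))
    show "preserves_seq_sups \<beta>"
      unfolding preserves_seq_sups_def
    proof (intro allI impI)
      fix x :: "nat \<Rightarrow> 'a realification" and u
      assume x: "incseq x" "is_seq_sup x u"
      have inc: "incseq (\<lambda>n. \<beta> (x n))"
        using x(1) by (simp add: mono_def mono)
      then obtain t where t: "is_seq_sup (\<lambda>n. \<beta> (x n)) t"
        using assms(2) unfolding axioms_O1_O5_def axiom_O1_def by blast
      have "t = \<beta> u"
        by (rule eqI)
          (simp add: functional_SUP[OF inc t] \<beta> realification_apply_seq_sup[OF assms(1) x])
      with t show "is_seq_sup (\<lambda>n. \<beta> (x n)) (\<beta> u)"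
        by simp
    qed
    show "\<forall>s. \<beta> (realification_hat s) = \<alpha> s"
      by (intro allI eqI) (simp add: \<beta> realification_hat.rep_eq hat_def pb)
  next
    fix \<gamma> :: "'a realification \<Rightarrow> 'b"
    assume "ordered_semigroup_map \<gamma> \<and> preserves_seq_sups \<gamma> \<and>
      (\<forall>s. \<gamma> (realification_hat s) = \<alpha> s)"
    then have \<gamma>: "ordered_semigroup_map \<gamma>" "preserves_seq_sups \<gamma>"
      "\<And>s. \<gamma> (realification_hat s) = \<alpha> s"
      by auto
    note \<gamma>D = ordered_semigroup_mapD[OF \<gamma>(1)]
    show "\<gamma> = \<beta>"
    proof (intro ext eqI)
      fix f :: "'a realification" and l
      obtain s n where n: "\<And>i. 0 < n i" and inc: "incseq (\<lambda>i l. hat (s i) l / of_nat (n i))"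
        and f: "\<And>l. realification_apply f l = (SUP i. hat (s i) l / of_nat (n i :: nat))"
        using repr[of f] by blast
      \<comment> \<open>Each quotient lies in the realification through a constant sequence, and
        \<open>f\<close> is their supremum there, so the values \<open>\<gamma> (x i)\<close>
        determine \<open>\<gamma> f\<close>.\<close>
      define x where "x i = Abs_realification (\<lambda>l. hat (s i) l / of_nat (n i))" for i
      have x: "realification_apply (x i) = (\<lambda>l. hat (s i) l / of_nat (n i))" for i
        unfolding x_def
        by (intro Abs_realification_inverse realification_setI[of "\<lambda>_. n i" "\<lambda>_. s i"] n) auto
      have x_inc: "incseq x"
        using inc by (simp add: mono_def less_eq_realification.rep_eq x)
      have "is_seq_sup x f"
        by (rule is_seq_supI) (auto simp: less_eq_realification.rep_eq x f le_fun_def SUP_le_iff intro: SUP_upper)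
      then have sup: "is_seq_sup (\<lambda>i. \<gamma> (x i)) (\<gamma> f)"
        using \<gamma>(2) x_inc unfolding preserves_seq_sups_def by blast
      have \<gamma>_inc: "incseq (\<lambda>i. \<gamma> (x i))"
        using x_inc by (simp add: mono_def \<gamma>D(1))
      have "functional_apply l (\<gamma> (x i)) = hat (s i) (pullback \<alpha> l) / of_nat (n i)" for i
      proof -
        have nsum_apply: "realification_apply (nsum k g) l = of_nat k * realification_apply g l" for k l
          and g :: "'a realification"
          by (induction k) (simp_all add: zero_realification.rep_eq plus_realification.rep_eq distrib_right)
        \<comment> \<open>Since \<open>n i\<close> copies of \<open>x i\<close> add up to the hat of
          \<open>s i\<close>, additivity fixes \<open>n i\<close> copies of
          \<open>\<gamma> (x i)\<close>. The division by \<open>n i\<close> takes place in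
          \<open>ennreal\<close>, after applying \<open>l\<close>.\<close>
        have "realification_apply (nsum (n i) (x i)) l = hat (s i) l" for l
        proof -
          have "of_nat (n i) \<noteq> (0::ennreal)" "of_nat (n i) \<noteq> (top::ennreal)"
            using n[of i] by auto
          then show ?thesis
            by (simp add: nsum_apply x ennreal_times_divide mult.commute[of "of_nat (n i)"] ennreal_mult_divide_eq)
        qed
        then have "nsum (n i) (x i) = realification_hat (s i)"
          by (simp add: realification_apply_inject[symmetric] realification_hat.rep_eq ext)
        moreover have "\<gamma> (nsum k g) = nsum k (\<gamma> g)" for k g
          by (induction k) (simp_all add: \<gamma>D)
        ultimately have "nsum (n i) (\<gamma> (x i)) = \<alpha> (s i)"
          using \<gamma>(3) by metis
        then have "of_nat (n i) * functional_apply l (\<gamma> (x i)) = hat (s i) (pullback \<alpha> l)"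
          by (metis functional_nsum pb hat_def)
        then show ?thesis
          using divide n by metis
      qed
      then show "functional_apply l (\<gamma> f) = functional_apply l (\<beta> f)"
        by (simp add: functional_SUP[OF \<gamma>_inc sup] \<beta> f)
    qed
  qed
qed

end
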